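(* Let $m=n\ge 2$ be integers and let $\Lambda\subseteq\{0,\ldots,m-1\}\times\{0,\ldots,n-1\}$ be nonempty. Then for every $z\in\mathbb{Z}^2$ the mass dimension $\dim_{\mathrm M}\mathcal{O}^+_\Lambda(z)$ exists and $$\mathrm{Dim}\,\mathcal{O}^+_\Lambda(z)=\log_m\#\Lambda$$ for each of the dimensions $\mathrm{Dim}\in\{\dim_{\mathrm{LH}},\dim_{\mathrm{DH}},\delta(\cdot),\dim_{\mathrm M},\dim_{\mathrm{DP}},\dim_{\mathrm{Be}},\dim_{\mathrm A}\}$.
   Context: **Orbit.** For $z=(u,v)\in\mathbb{Z}^2$ and $k\ge1$ let $$\Lambda_k(z)=\Big\{\Big(m^ku+\sum_{\ell=0}^{k-1}i_\ell m^\ell,\ n^kv+\sum_{\ell=0}^{k-1}j_\ell n^\ell\Big):(i_\ell,j_\ell)\in\Lambda\text{ for }0\le\ell<k\Big\},\qquad \mathcal{O}^+_\Lambda(z)=\bigcup_{k\ge1}\Lambda_k(z).$$ **Dimensions of $A\subseteq\mathbb{Z}^2$.** Mass: $\dim_{\mathrm{LM}}A$ and $\dim_{\mathrm{UM}}A$ are the $\liminf$ and $\limsup$ as $h\to+\infty$ of $\log\#(A\cap[-h,h]^2)/\log h$; if they agree, the common value is $\dim_{\mathrm M}A$. Beurling: $\dim_{\mathrm{Be}}A=\limsup_{h\to+\infty}\sup_{w\in\mathbb{R}^2}\dfrac{\log\#(A\cap(w+[-h,h]^2))}{\log h}$. Cubes: for $x\in\mathbb{Z}^2$ and $r\ge1$,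 $C(x,r)=\{y\in\mathbb{Z}^2:x_i\le y_i<x_i+r,\ i=1,2\}$ and $V(x,r)=\{y\in\mathbb{Z}^2:x_i-r/2\le y_i<x_i+r/2,\ i=1,2\}$; $\mathscr{C}=\{C(x,r):x\in\mathbb{Z}^2,\ r\in\mathbb{Z}_{>0}\}$. For a finite set $E\subset\mathbb{Z}^2$, $d(E)=\min\{r\in\mathbb{Z}_{>0}:E\subseteq C(x,r)\text{ for some }x\in\mathbb{Z}^2\}$. Put $V_k^{(2)}=V(0,2^k)$ for $k\ge 0$, $S_1^{(2)}=V_1^{(2)}$, $S_k^{(2)}=V_k^{(2)}\setminus V_{k-1}^{(2)}$ for $k\ge2$. For $F\subset\mathbb{Z}^2$ finite and nonempty and $\alpha>0$, $$\nu_\alpha(A,F)=\min\Big\{\sum_i\Big(\frac{d(U_i)}{d(F)}\Big)^\alpha:U_i\in\mathscr{C},\ A\cap F\subseteq\bigcup_iU_i\Big\}.$$ Discrete Hausdorff: $\dim_{\mathrm{DH}}A=\inf\{\alpha>0:\sum_{k\ge1}\nu_\alpha(A,S_k^{(2)})<\infty\}$. Lower discrete Hausdorff: $\dim_{\mathrm{LH}}A=\inf\{\alpha>0:\lim_{k\to\infty}\nu_\alpha(A,S_k^{(2)})=0\}$. For $r\ge1$, $N_r(A)$ is the minimum number of axis-parallel squares of side length $r$ needed to cover $A$, and $P_r(A)$ is the maximum cardinality of a family of pairwise disjoint axis-parallel squares of side length $r$ centered at points of $A$. (Scales $r$ may be taken real, in which case maxima/minima over $r$ mean suprema/infima, or integer;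 this does not affect the dimensions.) Discrete packing: $\dim_{\mathrm{DP}}A=\inf\{\alpha\ge0:\lim_{k\to\infty}\max_{1\le r\le2^{k(1-\varepsilon)}}(r/2^k)^\alpha P_r(A\cap S_k^{(2)})=0\text{ for each }\varepsilon\in(0,1)\}$. Lower entropy index: $\delta(A)=\inf\{\alpha\ge0:\lim_{k\to\infty}\min_{1\le r\le2^{k(1-\varepsilon)}}(r/2^k)^\alpha P_r(A\cap S_k^{(2)})=0\text{ for some }\varepsilon\in(0,1)\}$. Assouad (large-scale): $\dim_{\mathrm A}A=\inf\{\alpha\ge0:\exists C>0\text{ with }N_r(A\cap B(x,R))\le C(R/r)^\alpha\text{ for all }x\in A,\ 1\le r<R\}$, where $B(x,R)$ is the Euclidean ball. *)

theory Defs
  imports "HOL-Analysis.Analysis"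
begin

section \<open>The orbit\<close>

definition Lambda_iter ::
    "int \<Rightarrow> int \<Rightarrow> (int \<times> int) set \<Rightarrow> nat \<Rightarrow> int \<times> int \<Rightarrow> (int \<times> int) set" where
  "Lambda_iter m n \<Lambda> k z =
     {(m ^ k * fst z + (\<Sum>l<k. i l * m ^ l), n ^ k * snd z + (\<Sum>l<k. j l * n ^ l)) | i j.
        \<forall>l<k. (i l, j l) \<in> \<Lambda>}"

definition orbit_plus ::
    "int \<Rightarrow> int \<Rightarrow> (int \<times> int) set \<Rightarrow> int \<times> int \<Rightarrow> (int \<times> int) set" where
  "orbit_plus m n \<Lambda> z = (\<Union>k\<in>{1..}. Lambda_iter m n \<Lambda> k z)"

section \<open>Mass and Beurling dimensions\<close>

text \<open>All dimensions take values in the extended reals, so that an infimum over the empty set is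
  infinity and the logarithm of zero is minus infinity.\<close>

definition ln_card :: "'a set \<Rightarrow> ereal" where
  "ln_card A = (if card A = 0 then - \<infinity> else ereal (ln (real (card A))))"

definition box_pts :: "real \<times> real \<Rightarrow> real \<Rightarrow> (int \<times> int) set" where
  "box_pts w h = {y. \<bar>real_of_int (fst y) - fst w\<bar> \<le> h \<and> \<bar>real_of_int (snd y) - snd w\<bar> \<le> h}"

definition dim_LM :: "(int \<times> int) set \<Rightarrow> ereal" where
  "dim_LM A = Liminf at_top (\<lambda>h::real. ln_card (A \<inter> box_pts (0, 0) h) / ereal (ln h))"

definition dim_UM :: "(int \<times> int) set \<Rightarrow> ereal" where
  "dim_UM A = Limsup at_top (\<lambda>h::real. ln_card (A \<inter> box_pts (0, 0) h) / ereal (ln h))"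

text \<open>Meaningful only if the lower and the upper mass dimension agree.\<close>

definition dim_M :: "(int \<times> int) set \<Rightarrow> ereal" where
  "dim_M A = (THE d. dim_LM A = d \<and> dim_UM A = d)"

definition dim_Be :: "(int \<times> int) set \<Rightarrow> ereal" where
  "dim_Be A =
     Limsup at_top (\<lambda>h::real. SUP w. ln_card (A \<inter> box_pts w h) / ereal (ln h))"

section \<open>Discrete Hausdorff dimensions\<close>

definition cubeC :: "int \<times> int \<Rightarrow> nat \<Rightarrow> (int \<times> int) set" where
  "cubeC x r = {y. fst x \<le> fst y \<and> fst y < fst x + int r \<and> snd x \<le> snd y \<and> snd y < snd x + int r}"

definition cubeV :: "int \<times> int \<Rightarrow> nat \<Rightarrow> (int \<times> int) set" where
  "cubeV x r = {y.
     real_of_int (fst x) - real r / 2 \<le> real_of_int (fst y) \<and>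
     real_of_int (fst y) < real_of_int (fst x) + real r / 2 \<and>
     real_of_int (snd x) - real r / 2 \<le> real_of_int (snd y) \<and>
     real_of_int (snd y) < real_of_int (snd x) + real r / 2}"

definition cubes :: "(int \<times> int) set set" where
  "cubes = {cubeC x r | x r. r > 0}"

definition diam_cube :: "(int \<times> int) set \<Rightarrow> nat" where
  "diam_cube E = (LEAST r. r > 0 \<and> (\<exists>x. E \<subseteq> cubeC x r))"

definition V2 :: "nat \<Rightarrow> (int \<times> int) set" where
  "V2 k = cubeV (0, 0) (2 ^ k)"

text \<open>The shells are indexed by positive \<open>k\<close>; the value at 0 is the empty set.\<close>

definition S2 :: "nat \<Rightarrow> (int \<times> int) set" where
  "S2 k = (if k = 1 then V2 1 else V2 k - V2 (k - 1))"

text \<open>Finite families of cubes suffice: every cube in an infinite family contributes at least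
  \<open>(1 / d F)\<^sup>\<alpha>\<close>, and discarding repetitions only decreases the sum.  For \<open>\<alpha> > 0\<close> the
  infimum is attained, because only finitely many of the possible sums lie below any given bound.\<close>

definition nu :: "real \<Rightarrow> (int \<times> int) set \<Rightarrow> (int \<times> int) set \<Rightarrow> real" where
  "nu \<alpha> A F =
     Inf {(\<Sum>U\<in>\<U>. (real (diam_cube U) / real (diam_cube F)) powr \<alpha>) | \<U>.
            finite \<U> \<and> \<U> \<subseteq> cubes \<and> A \<inter> F \<subseteq> \<Union>\<U>}"

definition dim_DH :: "(int \<times> int) set \<Rightarrow> ereal" where
  "dim_DH A = Inf (ereal ` {\<alpha>. \<alpha> > 0 \<and> summable (\<lambda>k. nu \<alpha> A (S2 (Suc k)))})"

definition dim_LH :: "(int \<times> int) set \<Rightarrow> ereal" where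
  "dim_LH A = Inf (ereal ` {\<alpha>. \<alpha> > 0 \<and> (\<lambda>k. nu \<alpha> A (S2 k)) \<longlonglongrightarrow> 0})"

section \<open>Covering and packing numbers\<close>

definition emb :: "int \<times> int \<Rightarrow> real \<times> real" where
  "emb y = (real_of_int (fst y), real_of_int (snd y))"

definition square :: "real \<times> real \<Rightarrow> real \<Rightarrow> (real \<times> real) set" where
  "square c r = cbox (fst c - r / 2, snd c - r / 2) (fst c + r / 2, snd c + r / 2)"

text \<open>Both numbers are only used for finite \<open>A\<close>, for which the minimum and the maximum exist.\<close>

definition cover_num :: "real \<Rightarrow> (int \<times> int) set \<Rightarrow> nat" where
  "cover_num r A =
     (LEAST N. \<exists>Q. finite Q \<and> card Q = N \<and> Q \<subseteq> range (\<lambda>c. square c r) \<and> emb ` A \<subseteq> \<Union>Q)"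

definition pack_num :: "real \<Rightarrow> (int \<times> int) set \<Rightarrow> nat" where
  "pack_num r A = Max (card ` {Q. Q \<subseteq> (\<lambda>a. square (emb a) r) ` A \<and> pairwise disjnt Q})"

definition dim_DP :: "(int \<times> int) set \<Rightarrow> ereal" where
  "dim_DP A = Inf (ereal ` {\<alpha>. \<alpha> \<ge> 0 \<and> (\<forall>\<epsilon>\<in>{0<..<1}.
     (\<lambda>k::nat. SUP r\<in>{1..2 powr (real k * (1 - \<epsilon>))}.
        (r / 2 ^ k) powr \<alpha> * real (pack_num r (A \<inter> S2 k))) \<longlonglongrightarrow> 0)})"

definition lower_entropy_index :: "(int \<times> int) set \<Rightarrow> ereal" where
  "lower_entropy_index A = Inf (ereal ` {\<alpha>. \<alpha> \<ge> 0 \<and> (\<exists>\<epsilon>\<in>{0<..<1}.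
     (\<lambda>k::nat. INF r\<in>{1..2 powr (real k * (1 - \<epsilon>))}.
        (r / 2 ^ k) powr \<alpha> * real (pack_num r (A \<inter> S2 k))) \<longlonglongrightarrow> 0)})"

text \<open>The product metric on \<open>real \<times> real\<close> is the Euclidean one.\<close>

definition dim_A :: "(int \<times> int) set \<Rightarrow> ereal" where
  "dim_A A = Inf (ereal ` {\<alpha>. \<alpha> \<ge> 0 \<and> (\<exists>C>0. \<forall>x\<in>A. \<forall>r R. 1 \<le> r \<and> r < R \<longrightarrow>
     real (cover_num r (A \<inter> {y. emb y \<in> ball (emb x) R})) \<le> C * (R / r) powr \<alpha>)})"

end

theory Submission
  imports Defs
begin

text \<open>Write \<open>N\<close> for the number of digits and \<open>s = log\<^bsub>m\<^esub> N\<close>.  Since \<open>m = n\<close>, taking coordinatewise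
  quotients by \<open>m ^ j\<close> sends the points of level \<open>k \<ge> j\<close> of the orbit to points of level \<open>k - j\<close>, and
  its fibres are contained in squares of side \<open>m ^ j\<close>.  A square of side \<open>m ^ l\<close> meets at most four cells
  of scale \<open>m ^ l\<close>, so the part of the orbit inside it occupies at most of the order of
  \<open>(l - j + 1) * N ^ (l - j)\<close> cells of scale \<open>m ^ j\<close>; up to an arbitrarily small loss in the exponent
  this is the \<open>s\<close>-th power of the ratio of the scales, which bounds every dimension from above.

  Conversely, level \<open>K\<close> consists of \<open>N ^ K\<close> points, and a square of side \<open>\<rho>\<close> contains at most of the
  order of \<open>\<rho> powr s\<close> of them.  Counting measure on level \<open>K\<close> thus plays the role of a Frostman measure
  and bounds \<open>nu\<close> from below, hence \<open>dim_LH\<close>; maximal packings turn this into a bound for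
  \<open>lower_entropy_index\<close>.\<close>

section \<open>Cells, lattice squares and scales\<close>

text \<open>For \<open>M = m ^ j\<close> this drops the \<open>j\<close> lowest
  base-\<open>m\<close> digits of both coordinates. Since \<open>div\<close> rounds down for
  negative numbers too, for positive \<open>M\<close> the fibres are translates of one half-open
  square of side \<open>M\<close>.\<close>

definition cell :: "int \<Rightarrow> int \<times> int \<Rightarrow> int \<times> int" where
  "cell M p = (fst p div M, snd p div M)"

lemma cell_1 [simp]: "cell 1 p = p"
  by (simp add: cell_def)

lemma cell_cell: "M' \<ge> 0 \<Longrightarrow> cell M' (cell M p) = cell (M * M') p"
  by (simp add: cell_def zdiv_zmult2_eq)

lemma finite_cubeC [simp]: "finite (cubeC x r)"
proof -
  have "cubeC x r \<subseteq> {fst x..fst x + int r} \<times> {snd x..snd x + int r}"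
    by (auto simp: cubeC_def)
  then show ?thesis by (rule finite_subset) auto
qed

lemma div_two_values:
  fixes M c y :: int
  assumes "M > 0" "c \<le> y" "y < c + M"
  shows "y div M \<in> {c div M, c div M + 1}"
proof -
  have "c div M \<le> y div M" using assms by (simp add: zdiv_mono1)
  moreover have "y div M \<le> (c + M) div M" using assms by (intro zdiv_mono1) auto
  moreover have "(c + M) div M = c div M + 1" using assms by simp
  ultimately show ?thesis by auto
qed

text \<open>An interval of length at most \<open>M\<close> meets at most two consecutive blocks of
  length \<open>M\<close>, so the square meets at most two columns and two rows of cells.\<close>

lemma card_cell_cubeC:
  assumes "M > 0" "int r \<le> M" "E \<subseteq> cubeC x r"
  shows "card (cell M ` E) \<le> 4"
proof -
  let ?B = "{fst x div M, fst x div M + 1} \<times> {snd x div M, snd x div M + 1}"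
  have "cell M ` E \<subseteq> ?B"
  proof
    fix q assume "q \<in> cell M ` E"
    then obtain p where "p \<in> cubeC x r" "q = cell M p" using assms by blast
    then show "q \<in> ?B"
      using assms div_two_values[of M "fst x" "fst p"] div_two_values[of M "snd x" "snd p"]
      by (auto simp: cubeC_def cell_def)
  qed
  then have "card (cell M ` E) \<le> card ?B" by (rule card_mono[rotated]) auto
  also have "card ?B = 4" by (simp add: card_cartesian_product)
  finally show ?thesis .
qed

lemma box_pts_subset_cubeC:
  assumes "2 * h < real r"
  obtains x where "box_pts w h \<subseteq> cubeC x r"
proof
  show "box_pts w h \<subseteq> cubeC (\<lceil>fst w - h\<rceil>, \<lceil>snd w - h\<rceil>) r"
  proof
    fix y assume "y \<in> box_pts w h"
    then have *: "\<bar>real_of_int (fst y) - fst w\<bar> \<le> h" "\<bar>real_of_int (snd y) - snd w\<bar> \<le> h"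
      by (auto simp: box_pts_def)
    have "\<lceil>fst w - h\<rceil> \<le> fst y" "\<lceil>snd w - h\<rceil> \<le> snd y" using * by linarith+
    moreover have "fst y < \<lceil>fst w - h\<rceil> + int r" "snd y < \<lceil>snd w - h\<rceil> + int r"
      using * assms by linarith+
    ultimately show "y \<in> cubeC (\<lceil>fst w - h\<rceil>, \<lceil>snd w - h\<rceil>) r" by (auto simp: cubeC_def)
  qed
qed

lemma finite_box_pts [simp]: "finite (box_pts w h)"
proof -
  obtain r where "2 * h < real r" using reals_Archimedean2 by blast
  then obtain x where "box_pts w h \<subseteq> cubeC x r" by (rule box_pts_subset_cubeC)
  then show ?thesis by (rule finite_subset) simp
qed

text \<open>Rounding \<open>r\<close> down changes no comparison with the integers
  \<open>m ^ l\<close>, so the bracket of the natural number below \<open>r\<close> serves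
  \<open>r\<close> itself.\<close>

lemma power_bracket:
  fixes m :: int and r :: real
  assumes "2 \<le> m" "1 \<le> r"
  obtains l where "real_of_int m ^ l \<le> r" "r < real_of_int m ^ Suc l"
proof -
  have "2 \<le> nat m" "1 \<le> nat \<lfloor>r\<rfloor>" using assms by linarith+
  then obtain l where l: "nat m ^ l \<le> nat \<lfloor>r\<rfloor>" "nat \<lfloor>r\<rfloor> < nat m ^ (l + 1)"
    using ex_power_ivl1 by blast
  have e: "nat m ^ i = nat (m ^ i)" for i using assms by (simp add: nat_power_eq)
  have "m ^ l \<le> \<lfloor>r\<rfloor>" "\<lfloor>r\<rfloor> < m ^ Suc l"
    using l assms unfolding e by (auto simp: nat_le_eq_zle nat_less_eq_zless)
  then have "real_of_int (m ^ l) \<le> r" "r < real_of_int (m ^ Suc l)"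
    by (simp_all only: le_floor_iff floor_less_iff)
  then show ?thesis by (intro that[of l]) simp_all
qed

section \<open>Dyadic cubes and shells\<close>

text \<open>The half side \<open>2 ^ i\<close> is an integer only from index 1 on, hence the
  successor; \<open>V2 0\<close> has half side 1/2 and is the origin alone.\<close>

lemma V2_Suc: "V2 (Suc i) = cubeC (- (2 ^ i), - (2 ^ i)) (2 ^ Suc i)"
proof -
  have "- real (2 ^ Suc i) / 2 \<le> real_of_int a \<longleftrightarrow> - (2 ^ i) \<le> a"
    "real_of_int a < real (2 ^ Suc i) / 2 \<longleftrightarrow> a < 2 ^ i" for a :: int
  proof -
    have "real (2 ^ Suc i) / 2 = real_of_int (2 ^ i)" by simp
    then show "- real (2 ^ Suc i) / 2 \<le> real_of_int a \<longleftrightarrow> - (2 ^ i) \<le> a"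
      "real_of_int a < real (2 ^ Suc i) / 2 \<longleftrightarrow> a < 2 ^ i"
      by (simp_all only: minus_divide_left[symmetric] of_int_minus[symmetric] of_int_le_iff of_int_less_iff)
  qed
  then show ?thesis unfolding V2_def cubeV_def cubeC_def by auto
qed

lemma S2_subset_V2: "S2 k \<subseteq> V2 k"
  by (auto simp: S2_def)

lemma finite_V2 [simp]: "finite (V2 k)"
proof (cases k)
  case 0
  have "V2 0 \<subseteq> cubeC (-1, -1) 3" by (auto simp: V2_def cubeV_def cubeC_def)
  then show ?thesis using 0 finite_subset by fastforce
qed (simp add: V2_Suc)

lemma finite_S2 [simp]: "finite (S2 k)"
  using S2_subset_V2 finite_V2 by (rule finite_subset)

lemma V2_Suc_subset: "V2 (Suc k) \<subseteq> V2 k \<union> S2 (Suc k)"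
  by (auto simp: S2_def)

lemma box_pts_subset_V2:
  assumes "h < 2 ^ k"
  shows "box_pts (0, 0) h \<subseteq> V2 (Suc k)"
proof
  fix y assume "y \<in> box_pts (0, 0) h"
  then have "\<bar>real_of_int (fst y)\<bar> \<le> h" "\<bar>real_of_int (snd y)\<bar> \<le> h"
    by (auto simp: box_pts_def)
  moreover have "real (2 ^ Suc k) / 2 = 2 ^ k" by simp
  ultimately show "y \<in> V2 (Suc k)" using assms
    unfolding V2_def cubeV_def mem_Collect_eq fst_conv snd_conv by linarith
qed

lemma V2_subset_box_pts: "V2 k \<subseteq> box_pts (0, 0) (2 ^ k)"
proof
  fix y assume "y \<in> V2 k"
  then have "- ((2 ^ k) / 2) \<le> real_of_int (fst y)" "real_of_int (fst y) < (2 ^ k) / 2"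
    "- ((2 ^ k) / 2) \<le> real_of_int (snd y)" "real_of_int (snd y) < (2 ^ k) / 2"
    unfolding V2_def cubeV_def by simp_all
  moreover have "(0::real) < 2 ^ k" by simp
  ultimately show "y \<in> box_pts (0, 0) (2 ^ k)"
    unfolding box_pts_def mem_Collect_eq fst_conv snd_conv by linarith
qed

section \<open>Cube diameters and the covering functional\<close>

text \<open>A finite set is bounded, so some cube contains it and the \<open>LEAST\<close> in
  \<open>diam_cube\<close> is attained.\<close>

lemma diam_cube_cover:
  assumes "finite E"
  obtains x where "diam_cube E > 0" "E \<subseteq> cubeC x (diam_cube E)"
proof -
  obtain B where B: "\<And>y. y \<in> E \<Longrightarrow> \<bar>fst y\<bar> \<le> B \<and> \<bar>snd y\<bar> \<le> B"
  proof
    fix y assume "y \<in> E"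
    then have "\<bar>fst y\<bar> + \<bar>snd y\<bar> \<le> (\<Sum>y\<in>E. \<bar>fst y\<bar> + \<bar>snd y\<bar>)"
      using assms by (intro member_le_sum) auto
    then show "\<bar>fst y\<bar> \<le> (\<Sum>y\<in>E. \<bar>fst y\<bar> + \<bar>snd y\<bar>) \<and> \<bar>snd y\<bar> \<le> (\<Sum>y\<in>E. \<bar>fst y\<bar> + \<bar>snd y\<bar>)"
      by linarith
  qed
  have "E \<subseteq> cubeC (- \<bar>B\<bar>, - \<bar>B\<bar>) (nat (2 * \<bar>B\<bar> + 1))"
    using B by (force simp: cubeC_def)
  then have "\<exists>r. r > 0 \<and> (\<exists>x. E \<subseteq> cubeC x r)" by (intro exI[of _ "nat (2 * \<bar>B\<bar> + 1)"]) auto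
  from LeastI_ex[OF this] show ?thesis using that unfolding diam_cube_def by blast
qed

lemma diam_cubeC_le: "r > 0 \<Longrightarrow> diam_cube (cubeC x r) \<le> r"
  unfolding diam_cube_def by (rule Least_le) blast

text \<open>Two opposite corners of \<open>V2 (Suc i)\<close> lie outside \<open>V2 i\<close>, hence
  in the shell, and they already force the full side.\<close>

lemma diam_S2: "diam_cube (S2 (Suc i)) = 2 ^ Suc i"
proof (rule antisym)
  show "diam_cube (S2 (Suc i)) \<le> 2 ^ Suc i"
    unfolding diam_cube_def using S2_subset_V2[of "Suc i"] by (intro Least_le) (auto simp: V2_Suc)
  obtain x where x: "S2 (Suc i) \<subseteq> cubeC x (diam_cube (S2 (Suc i)))"
    by (rule diam_cube_cover[OF finite_S2])
  have "(- (2 ^ i), - (2 ^ i)) \<in> S2 (Suc i)" "(2 ^ i - 1, 2 ^ i - 1) \<in> S2 (Suc i)"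
  proof -
    have *: "(- (2 ^ i), - (2 ^ i)) \<in> V2 (Suc i)" "(2 ^ i - 1, 2 ^ i - 1) \<in> V2 (Suc i)"
      by (auto simp: V2_Suc cubeC_def)
    have "(- (2 ^ i), - (2 ^ i)) \<notin> V2 i \<and> (2 ^ i - 1, 2 ^ i - 1) \<notin> V2 i" if "i > 0"
    proof -
      obtain j where "i = Suc j" using \<open>i > 0\<close> gr0_conv_Suc by blast
      moreover have "(1::int) \<le> 2 ^ j" by simp
      ultimately show ?thesis by (simp add: V2_Suc cubeC_def not_less)
    qed
    with * show "(- (2 ^ i), - (2 ^ i)) \<in> S2 (Suc i)" "(2 ^ i - 1, 2 ^ i - 1) \<in> S2 (Suc i)"
      by (cases "i = 0"; auto simp: S2_def)+
  qed
  then have "(- (2 ^ i), - (2 ^ i)) \<in> cubeC x (diam_cube (S2 (Suc i)))"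
    "(2 ^ i - 1, 2 ^ i - 1) \<in> cubeC x (diam_cube (S2 (Suc i)))" using x by blast+
  then have "2 ^ i - 1 < - (2 ^ i) + int (diam_cube (S2 (Suc i)))" by (simp add: cubeC_def)
  then have "int (2 ^ Suc i) \<le> int (diam_cube (S2 (Suc i)))" by simp
  then show "2 ^ Suc i \<le> diam_cube (S2 (Suc i))" by linarith
qed

lemma nu_le:
  assumes "finite \<U>" "\<U> \<subseteq> cubes" "A \<inter> F \<subseteq> \<Union>\<U>"
  shows "nu \<alpha> A F \<le> (\<Sum>U\<in>\<U>. (real (diam_cube U) / real (diam_cube F)) powr \<alpha>)"
  unfolding nu_def
  by (rule cInf_lower) (use assms in \<open>auto intro!: bdd_belowI[of _ 0] sum_nonneg\<close>)

text \<open>A lower bound for every cover passes to the real \<open>Inf\<close> only if some cover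
  exists; a single cube around the finite set \<open>A \<inter> F\<close> is one.\<close>

lemma nu_greatest:
  assumes "finite (A \<inter> F)"
    "\<And>\<U>. finite \<U> \<Longrightarrow> \<U> \<subseteq> cubes \<Longrightarrow> A \<inter> F \<subseteq> \<Union>\<U> \<Longrightarrow>
       c \<le> (\<Sum>U\<in>\<U>. (real (diam_cube U) / real (diam_cube F)) powr \<alpha>)"
  shows "c \<le> nu \<alpha> A F"
proof -
  obtain x where "diam_cube (A \<inter> F) > 0" "A \<inter> F \<subseteq> cubeC x (diam_cube (A \<inter> F))"
    using diam_cube_cover[OF assms(1)] by blast
  then have "finite {cubeC x (diam_cube (A \<inter> F))} \<and> {cubeC x (diam_cube (A \<inter> F))} \<subseteq> cubes
      \<and> A \<inter> F \<subseteq> \<Union>{cubeC x (diam_cube (A \<inter> F))}"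
    unfolding cubes_def by blast
  then show ?thesis unfolding nu_def by (intro cInf_greatest) (use assms(2) in blast)+
qed

lemma nu_nonneg: "finite (A \<inter> F) \<Longrightarrow> 0 \<le> nu \<alpha> A F"
  by (rule nu_greatest) (auto intro: sum_nonneg)

text \<open>The cubes are indexed by \<open>P\<close> rather than collected in a set; coinciding
  cubes only make the sum smaller.\<close>

lemma nu_le_cubes:
  assumes P: "finite P" "A \<inter> F \<subseteq> (\<Union>x\<in>P. cubeC (f x) r)" and "r > 0" "\<alpha> \<ge> 0"
  shows "nu \<alpha> A F \<le> real (card P) * (real r / real (diam_cube F)) powr \<alpha>"
proof -
  let ?U = "(\<lambda>x. cubeC (f x) r) ` P"
  have "nu \<alpha> A F \<le> (\<Sum>U\<in>?U. (real (diam_cube U) / real (diam_cube F)) powr \<alpha>)"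
    using assms by (intro nu_le) (simp_all, auto simp only: cubes_def)
  also have "\<dots> \<le> (\<Sum>U\<in>?U. (real r / real (diam_cube F)) powr \<alpha>)"
    using assms diam_cubeC_le[OF \<open>r > 0\<close>, of "f _"]
    by (intro sum_mono powr_mono2 divide_right_mono) auto
  also have "\<dots> = real (card ?U) * (real r / real (diam_cube F)) powr \<alpha>" by simp
  also have "\<dots> \<le> real (card P) * (real r / real (diam_cube F)) powr \<alpha>"
    using card_image_le[OF P(1)] by (intro mult_right_mono) auto
  finally show ?thesis .
qed

section \<open>Packings and coverings by real squares\<close>

lemma mem_square: "q \<in> square c r \<longleftrightarrow> \<bar>fst q - fst c\<bar> \<le> r / 2 \<and> \<bar>snd q - snd c\<bar> \<le> r / 2"
proof -
  have "\<bar>a - b\<bar> \<le> r / 2 \<longleftrightarrow> b - r / 2 \<le> a \<and> a \<le> b + r / 2" for a b by linarith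
  then show ?thesis unfolding square_def cbox_Pair_eq by (cases q) auto
qed

text \<open>If the centres are within \<open>r\<close> in the maximum norm, their midpoint lies in
  both closed squares; the other direction is the triangle inequality.\<close>

lemma squares_meet_iff:
  "\<not> disjnt (square (emb a) r) (square (emb b) r) \<longleftrightarrow>
     \<bar>real_of_int (fst a) - real_of_int (fst b)\<bar> \<le> r \<and> \<bar>real_of_int (snd a) - real_of_int (snd b)\<bar> \<le> r"
proof
  assume "\<not> disjnt (square (emb a) r) (square (emb b) r)"
  then obtain q where "q \<in> square (emb a) r" "q \<in> square (emb b) r" by (auto simp: disjnt_def)
  then show "\<bar>real_of_int (fst a) - real_of_int (fst b)\<bar> \<le> r \<and> \<bar>real_of_int (snd a) - real_of_int (snd b)\<bar> \<le> r"
    unfolding mem_square emb_def fst_conv snd_conv by linarith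
next
  let ?q = "((fst (emb a) + fst (emb b)) / 2, (snd (emb a) + snd (emb b)) / 2)"
  assume "\<bar>real_of_int (fst a) - real_of_int (fst b)\<bar> \<le> r \<and> \<bar>real_of_int (snd a) - real_of_int (snd b)\<bar> \<le> r"
  then have "?q \<in> square (emb a) r" "?q \<in> square (emb b) r"
    by (auto simp: mem_square emb_def abs_le_iff field_simps)
  then show "\<not> disjnt (square (emb a) r) (square (emb b) r)" by (auto simp: disjnt_def)
qed

lemma same_cell_close:
  assumes "M > 0" "real_of_int M \<le> r" "cell M p = cell M q"
  shows "\<bar>real_of_int (fst p) - real_of_int (fst q)\<bar> \<le> r" "\<bar>real_of_int (snd p) - real_of_int (snd q)\<bar> \<le> r"
proof -
  have *: "\<bar>real_of_int a - real_of_int b\<bar> \<le> r" if "a div M = b div M" for a b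
  proof -
    have "a = M * (b div M) + a mod M" "b = M * (b div M) + b mod M"
      using mult_div_mod_eq[of M a] that by simp_all
    moreover have "0 \<le> a mod M" "a mod M < M" "0 \<le> b mod M" "b mod M < M" using assms by simp_all
    ultimately have "\<bar>a - b\<bar> \<le> M" by linarith
    then have "real_of_int \<bar>a - b\<bar> \<le> real_of_int M" by (simp only: of_int_le_iff)
    then show ?thesis using assms(2) by simp
  qed
  then show "\<bar>real_of_int (fst p) - real_of_int (fst q)\<bar> \<le> r" "\<bar>real_of_int (snd p) - real_of_int (snd q)\<bar> \<le> r"
    using assms(3) by (auto simp: cell_def)
qed

text \<open>Squares of side \<open>r\<close> centred at two points of one cell intersect, because
  the cell has side at most \<open>r\<close>. So the centres of a packing occupy distinct
  cells.\<close>

lemma pack_num_le_cells: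
  assumes "finite E" "M > 0" "real_of_int M \<le> r"
  shows "pack_num r E \<le> card (cell M ` E)"
  unfolding pack_num_def
proof (rule Max.boundedI)
  let ?g = "\<lambda>a. square (emb a) r"
  let ?S = "{Q. Q \<subseteq> ?g ` E \<and> pairwise disjnt Q}"
  have "?S \<subseteq> Pow (?g ` E)" by auto
  moreover have "finite (Pow (?g ` E))" using assms by simp
  ultimately have "finite ?S" by (rule finite_subset)
  then show "finite (card ` ?S)" by (rule finite_imageI)
  show "card ` ?S \<noteq> {}" by (auto intro!: exI[of _ "{}"])
  fix n assume "n \<in> card ` ?S"
  then obtain Q where Q: "Q \<subseteq> ?g ` E" "pairwise disjnt Q" "n = card Q" by auto
  \<comment> \<open>Chooses one centre for each square of the packing.\<close>
  then obtain E' where E': "E' \<subseteq> E" "inj_on ?g E'" "Q = ?g ` E'"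
    by (auto simp: subset_image_inj)
  have "inj_on (cell M) E'"
  proof (rule inj_onI)
    fix p q assume pq: "p \<in> E'" "q \<in> E'" "cell M p = cell M q"
    have "\<not> disjnt (?g p) (?g q)"
      using same_cell_close[OF assms(2,3) pq(3)] by (simp add: squares_meet_iff)
    then have "?g p = ?g q" using Q(2) pq unfolding E' pairwise_def by blast
    then show "p = q" using E'(2) pq by (auto dest: inj_onD)
  qed
  then have "n = card (cell M ` E')" using Q E' by (simp add: card_image)
  also have "\<dots> \<le> card (cell M ` E)" using assms E' by (intro card_mono) auto
  finally show "n \<le> card (cell M ` E)" .
qed

text \<open>The centres of a packing of maximal size form an \<open>r\<close>-net in the maximum
  norm: a point farther than \<open>r\<close> from all of them would contribute one more disjoint
  square.\<close>

lemma cover_by_packing: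
  assumes "finite E" "r \<ge> 0"
  obtains P where "finite P" "card P = pack_num r E"
    "\<And>p. p \<in> E \<Longrightarrow> \<exists>q\<in>P. \<bar>real_of_int (fst p) - real_of_int (fst q)\<bar> \<le> r \<and>
       \<bar>real_of_int (snd p) - real_of_int (snd q)\<bar> \<le> r"
proof -
  let ?g = "\<lambda>a. square (emb a) r"
  let ?S = "{Q. Q \<subseteq> ?g ` E \<and> pairwise disjnt Q}"
  have "?S \<subseteq> Pow (?g ` E)" by auto
  moreover have "finite (Pow (?g ` E))" using assms by simp
  ultimately have "finite ?S" by (rule finite_subset)
  then have fin: "finite (card ` ?S)" by (rule finite_imageI)
  have "card ` ?S \<noteq> {}" by (auto intro!: exI[of _ "{}"])
  then have "pack_num r E \<in> card ` ?S" unfolding pack_num_def using fin by (rule Max_in[rotated])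
  then obtain Q where Q: "Q \<subseteq> ?g ` E" "pairwise disjnt Q" "card Q = pack_num r E" by auto
  then obtain E' where E': "E' \<subseteq> E" "inj_on ?g E'" "Q = ?g ` E'"
    by (auto simp: subset_image_inj)
  show ?thesis
  proof (rule that[of E'])
    show "finite E'" using E' assms finite_subset by blast
    show "card E' = pack_num r E" using E' Q by (simp add: card_image)
    fix p assume p: "p \<in> E"
    have "\<exists>q\<in>E'. \<not> disjnt (?g p) (?g q)"
    proof (rule ccontr)
      assume "\<not> ?thesis"
      then have dis: "\<forall>X\<in>Q. disjnt (?g p) X" unfolding E' by blast
      \<comment> \<open>As \<open>r \<ge> 0\<close> the square is nonempty and so not disjoint from
        itself. Hence it is not yet in \<open>Q\<close>, and inserting it would raise the
        cardinality above the maximum.\<close>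
      have self: "\<not> disjnt (?g p) (?g p)" unfolding squares_meet_iff using assms by simp
      then have "?g p \<notin> Q" using dis by blast
      moreover have "insert (?g p) Q \<in> ?S" using p Q dis by (auto simp: pairwise_insert disjnt_sym simp del: disjnt_self_iff_empty)
      then have "card (insert (?g p) Q) \<le> pack_num r E"
        unfolding pack_num_def by (intro Max_ge[OF fin] imageI)
      moreover have "finite Q" using Q(1) assms finite_subset by blast
      ultimately show False using Q(3) by simp
    qed
    then show "\<exists>q\<in>E'. \<bar>real_of_int (fst p) - real_of_int (fst q)\<bar> \<le> r \<and>
       \<bar>real_of_int (snd p) - real_of_int (snd q)\<bar> \<le> r"
      by (simp add: squares_meet_iff)
  qed
qed

text \<open>Cubes around the centres of a maximal packing cover the set, at the cost of a constant
  factor in the side. This transfers lower bounds for \<open>nu\<close> to packing numbers.\<close>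

lemma nu_le_pack_num:
  assumes "1 \<le> r" "\<alpha> \<ge> 0"
  shows "nu \<alpha> A (S2 (Suc i)) \<le> 3 powr \<alpha> * ((r / 2 ^ Suc i) powr \<alpha> * real (pack_num r (A \<inter> S2 (Suc i))))"
proof -
  obtain P where P: "finite P" "card P = pack_num r (A \<inter> S2 (Suc i))"
    "\<And>p. p \<in> A \<inter> S2 (Suc i) \<Longrightarrow> \<exists>q\<in>P. \<bar>real_of_int (fst p) - real_of_int (fst q)\<bar> \<le> r \<and>
       \<bar>real_of_int (snd p) - real_of_int (snd q)\<bar> \<le> r"
    using cover_by_packing[of "A \<inter> S2 (Suc i)" r] assms by (auto intro: finite_subset)
  \<comment> \<open>Integers that differ by at most \<open>r\<close> differ by at most its floor, so
    this odd side suffices; it is at most \<open>3 * r\<close> because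
    \<open>r \<ge> 1\<close>.\<close>
  define k where "k = nat (2 * \<lfloor>r\<rfloor> + 1)"
  have k: "k > 0" "real k \<le> 3 * r" "int k = 2 * \<lfloor>r\<rfloor> + 1" using assms unfolding k_def by linarith+
  have "A \<inter> S2 (Suc i) \<subseteq> (\<Union>q\<in>P. cubeC (fst q - \<lfloor>r\<rfloor>, snd q - \<lfloor>r\<rfloor>) k)"
  proof
    fix p assume "p \<in> A \<inter> S2 (Suc i)"
    then obtain q where q: "q \<in> P" "\<bar>real_of_int (fst p) - real_of_int (fst q)\<bar> \<le> r"
       "\<bar>real_of_int (snd p) - real_of_int (snd q)\<bar> \<le> r" using P(3) by blast
    then have "fst p - fst q \<le> \<lfloor>r\<rfloor>" "fst q - fst p \<le> \<lfloor>r\<rfloor>" "snd p - snd q \<le> \<lfloor>r\<rfloor>" "snd q - snd p \<le> \<lfloor>r\<rfloor>"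
      by linarith+
    then have "p \<in> cubeC (fst q - \<lfloor>r\<rfloor>, snd q - \<lfloor>r\<rfloor>) k" using k(3) by (simp add: cubeC_def)
    then show "p \<in> (\<Union>q\<in>P. cubeC (fst q - \<lfloor>r\<rfloor>, snd q - \<lfloor>r\<rfloor>) k)" using q(1) by blast
  qed
  from nu_le_cubes[OF P(1) this k(1) assms(2)]
  have "nu \<alpha> A (S2 (Suc i)) \<le> real (pack_num r (A \<inter> S2 (Suc i))) * (real k / 2 ^ Suc i) powr \<alpha>"
    by (simp add: diam_S2 P(2))
  also have "\<dots> \<le> real (pack_num r (A \<inter> S2 (Suc i))) * (3 * (r / 2 ^ Suc i)) powr \<alpha>"
    using k assms by (intro mult_left_mono powr_mono2) (auto simp: divide_right_mono)
  also have "(3 * (r / 2 ^ Suc i)) powr \<alpha> = 3 powr \<alpha> * (r / 2 ^ Suc i) powr \<alpha>"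
    by (rule powr_mult)
  finally show ?thesis by (simp only: mult_ac)
qed

text \<open>A cell of side \<open>M \<le> r\<close> fits into the closed square of side
  \<open>r\<close> with the same lower left corner.\<close>

lemma cover_num_le_cells:
  assumes "finite E" "M > 0" "real_of_int M \<le> r"
  shows "cover_num r E \<le> card (cell M ` E)"
proof -
  let ?h = "\<lambda>q. square (real_of_int (M * fst q) + r / 2, real_of_int (M * snd q) + r / 2) r"
  have *: "emb p \<in> ?h (cell M p)" for p
  proof -
    have "\<bar>real_of_int a - (real_of_int (M * (a div M)) + r / 2)\<bar> \<le> r / 2" for a
    proof -
      have "a = M * (a div M) + a mod M" "0 \<le> a mod M" "a mod M < M" using assms by simp_all
      then have "real_of_int (M * (a div M)) \<le> real_of_int a" "real_of_int a \<le> real_of_int (M * (a div M)) + real_of_int M"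
        by (simp only: of_int_le_iff of_int_add[symmetric], linarith)+
      then show ?thesis using assms(3) by linarith
    qed
    then show ?thesis unfolding mem_square by (simp add: emb_def cell_def)
  qed
  have "cover_num r E \<le> card (?h ` cell M ` E)"
    unfolding cover_num_def
  proof (intro Least_le exI conjI)
    show "finite (?h ` cell M ` E)" using assms by simp
    show "emb ` E \<subseteq> \<Union>(?h ` cell M ` E)" using * by blast
  qed auto
  also have "\<dots> \<le> card (cell M ` E)" using assms by (intro card_image_le) simp
  finally show ?thesis .
qed

text \<open>A closed interval of length 1 contains at most two integers, so a unit square contains
  at most four lattice points.\<close>

lemma card_le_cover_num:
  assumes "finite E"
  shows "card E \<le> 4 * cover_num 1 E"
proof -
  let ?P = "\<lambda>N. \<exists>Q. finite Q \<and> card Q = N \<and> Q \<subseteq> range (\<lambda>c. square c 1) \<and> emb ` E \<subseteq> \<Union>Q"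
  \<comment> \<open>Unit squares centred at the points themselves show that the \<open>LEAST\<close>
    in \<open>cover_num\<close> is attained.\<close>
  have "?P (card ((\<lambda>a. square (emb a) 1) ` E))"
    using assms by (intro exI[of _ "(\<lambda>a. square (emb a) 1) ` E"]) (auto simp: mem_square)
  then have "?P (cover_num 1 E)" unfolding cover_num_def by (rule LeastI)
  then obtain Q where Q: "finite Q" "card Q = cover_num 1 E" "Q \<subseteq> range (\<lambda>c. square c 1)"
    "emb ` E \<subseteq> \<Union>Q" by blast
  have *: "card {y. emb y \<in> X} \<le> 4 \<and> finite {y. emb y \<in> X}" if "X \<in> Q" for X
  proof -
    obtain c where c: "X = square c 1" using Q \<open>X \<in> Q\<close> by blast
    let ?B = "{\<lceil>fst c - 1 / 2\<rceil>, \<lceil>fst c - 1 / 2\<rceil> + 1} \<times> {\<lceil>snd c - 1 / 2\<rceil>, \<lceil>snd c - 1 / 2\<rceil> + 1}"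
    have **: "a = \<lceil>t - 1 / 2\<rceil> \<or> a = \<lceil>t - 1 / 2\<rceil> + 1" if "\<bar>real_of_int a - t\<bar> \<le> 1 / 2" for a t
      using that by linarith
    have sub: "{y. emb y \<in> X} \<subseteq> ?B"
    proof
      fix y assume "y \<in> {y. emb y \<in> X}"
      then have "\<bar>real_of_int (fst y) - fst c\<bar> \<le> 1 / 2" "\<bar>real_of_int (snd y) - snd c\<bar> \<le> 1 / 2"
        by (auto simp: c mem_square emb_def)
      from this[THEN **] show "y \<in> ?B" by (cases y) auto
    qed
    have "card {y. emb y \<in> X} \<le> card ?B" using sub by (rule card_mono[rotated]) auto
    moreover have "card ?B = 4" by (simp add: card_cartesian_product)
    moreover have "finite {y. emb y \<in> X}" using sub by (rule finite_subset) auto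
    ultimately show ?thesis by simp
  qed
  have "E \<subseteq> (\<Union>X\<in>Q. {y. emb y \<in> X})" using Q(4) by auto
  then have "card E \<le> card (\<Union>X\<in>Q. {y. emb y \<in> X})" using * Q by (intro card_mono) auto
  also have "\<dots> \<le> (\<Sum>X\<in>Q. card {y. emb y \<in> X})" using Q by (intro card_UN_le) auto
  also have "\<dots> \<le> (\<Sum>X\<in>Q. 4)" using * by (intro sum_mono) auto
  finally show ?thesis using Q by simp
qed

section \<open>Growth rates and extended real bounds\<close>

lemma powr_eventually_dominates:
  fixes \<alpha> \<beta> C :: real
  assumes "\<alpha> < \<beta>"
  shows "eventually (\<lambda>h. C * h powr \<alpha> \<le> h powr \<beta>) at_top"
proof -
  \<comment> \<open>From this threshold on, \<open>h powr (\<beta> - \<alpha>)\<close> is at least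
    \<open>max 1 C\<close>.\<close>
  have "eventually (\<lambda>h. h \<ge> max 1 (max 1 C powr (1 / (\<beta> - \<alpha>)))) at_top" by (rule eventually_ge_at_top)
  then show ?thesis
  proof eventually_elim
    case (elim h)
    have "max 1 C = (max 1 C powr (1 / (\<beta> - \<alpha>))) powr (\<beta> - \<alpha>)"
      using assms by (simp add: powr_powr)
    also have "\<dots> \<le> h powr (\<beta> - \<alpha>)" using elim assms by (intro powr_mono2) auto
    finally have "C * h powr \<alpha> \<le> h powr (\<beta> - \<alpha>) * h powr \<alpha>" by (intro mult_right_mono) auto
    then show ?case by (simp flip: powr_add)
  qed
qed

lemma ln_card_ratio_le:
  assumes "h > 1" "real (card B) \<le> h powr \<beta>"
  shows "ln_card B / ereal (ln h) \<le> ereal \<beta>"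
proof (cases "card B = 0")
  \<comment> \<open>Cardinality zero gives minus infinity, which division by the positive
    \<open>ln h\<close> preserves.\<close>
  case True
  then show ?thesis using assms by (simp add: ln_card_def divide_ereal_def)
next
  case False
  then have "ln (real (card B)) \<le> ln (h powr \<beta>)" using assms by (subst ln_le_cancel_iff) auto
  then have "ln (real (card B)) \<le> \<beta> * ln h" using assms by (simp add: ln_powr)
  then show ?thesis using False assms by (simp add: ln_card_def divide_le_eq)
qed

lemma ln_card_ratio_ge:
  assumes "h > 1" "h powr \<beta> \<le> real (card B)"
  shows "ereal \<beta> \<le> ln_card B / ereal (ln h)"
proof -
  have "0 < h powr \<beta>" using assms by simp
  then have B: "real (card B) > 0" using assms by linarith
  then have "ln (h powr \<beta>) \<le> ln (real (card B))" using assms by (subst ln_le_cancel_iff) auto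
  then have "\<beta> * ln h \<le> ln (real (card B))" using assms by (simp add: ln_powr)
  then show ?thesis using B assms by (simp add: ln_card_def le_divide_eq)
qed

lemma ereal_le_of_greater:
  assumes "\<And>\<beta>. t < \<beta> \<Longrightarrow> d \<le> ereal \<beta>"
  shows "d \<le> ereal t"
  by (rule ereal_le_epsilon2) (use assms in auto)

lemma ereal_ge_of_less:
  assumes "\<And>\<beta>. \<beta> < t \<Longrightarrow> ereal \<beta> \<le> d"
  shows "ereal t \<le> d"
proof (rule ereal_le_epsilon2)
  fix e :: real assume "0 < e"
  then have "ereal (t - e) + ereal e \<le> d + ereal e" by (intro add_right_mono assms) simp
  then show "ereal t \<le> d + ereal e" by simp
qed

section \<open>Comparisons valid for every set\<close>

lemma dim_UM_le_Be: "dim_UM X \<le> dim_Be X"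
  unfolding dim_UM_def dim_Be_def
  by (intro Limsup_mono always_eventually allI SUP_upper2[of "(0, 0)"]) auto

lemma dim_LM_le_UM: "dim_LM X \<le> dim_UM X"
  unfolding dim_UM_def dim_LM_def by (intro Liminf_le_Limsup) simp

lemma dim_LH_le_DH: "dim_LH X \<le> dim_DH X"
proof -
  have "{\<alpha>. \<alpha> > 0 \<and> summable (\<lambda>k. nu \<alpha> X (S2 (Suc k)))} \<subseteq> {\<alpha>. \<alpha> > 0 \<and> (\<lambda>k. nu \<alpha> X (S2 k)) \<longlonglongrightarrow> 0}"
    using LIMSEQ_imp_Suc[OF summable_LIMSEQ_zero] by auto
  then show ?thesis unfolding dim_LH_def dim_DH_def by (intro Inf_superset_mono image_mono)
qed

text \<open>For one and the same \<epsilon> the infimum over \<open>r\<close> is at most the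
  supremum. The smaller side asks for some \<epsilon> only, so 1/2 serves.\<close>

lemma lower_entropy_index_le_DP: "lower_entropy_index X \<le> dim_DP X"
  unfolding lower_entropy_index_def dim_DP_def
proof (intro Inf_superset_mono image_mono Collect_mono impI conjI; elim conjE)
  fix \<alpha> :: real
  let ?t = "\<lambda>k r. (r / 2 ^ k) powr \<alpha> * real (pack_num r (X \<inter> S2 k))"
  let ?I = "\<lambda>\<epsilon> k::nat. {1..2 powr (real k * (1 - \<epsilon>))}"
  assume \<alpha>: "0 \<le> \<alpha>" and lim: "\<forall>\<epsilon>\<in>{0<..<1}. (\<lambda>k. SUP r\<in>?I \<epsilon> k. ?t k r) \<longlonglongrightarrow> 0"
  let ?h = "1 / 2 :: real"
  have one: "1 \<in> ?I ?h k" for k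
    using ge_one_powr_ge_zero[of 2 "real k * (1 - ?h)"] by simp
  have t0: "0 \<le> ?t k r" for k r by simp
  have bb: "bdd_below (?t k ` ?I ?h k)" for k by (rule bdd_belowI2[of _ 0]) (rule t0)
  \<comment> \<open>A real \<open>SUP\<close> is sure to dominate its members only over a bounded
    set; here \<open>r\<close> is bounded and packing numbers are at most the cardinality.\<close>
  have ba: "bdd_above (?t k ` ?I ?h k)" for k
  proof (rule bdd_aboveI2)
    fix r assume r: "r \<in> ?I ?h k"
    have "pack_num r (X \<inter> S2 k) \<le> card (cell 1 ` (X \<inter> S2 k))"
      using r by (intro pack_num_le_cells) auto
    then have "pack_num r (X \<inter> S2 k) \<le> card (X \<inter> S2 k)" by simp
    then show "?t k r \<le> (2 powr (real k * (1 - ?h)) / 2 ^ k) powr \<alpha> * real (card (X \<inter> S2 k))"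
      using r \<alpha> by (intro mult_mono powr_mono2 divide_right_mono) auto
  qed
  have lower: "0 \<le> (INF r\<in>?I ?h k. ?t k r)" for k
    by (rule cINF_greatest) (use one t0 in blast)+
  have upper: "(INF r\<in>?I ?h k. ?t k r) \<le> (SUP r\<in>?I ?h k. ?t k r)" for k
    using cINF_lower[OF bb one] cSUP_upper[OF one ba] by (rule order_trans)
  have h: "?h \<in> {0<..<1}" by simp
  have "(\<lambda>k. INF r\<in>?I ?h k. ?t k r) \<longlonglongrightarrow> 0"
    using tendsto_sandwich[OF always_eventually[OF allI[OF lower]] always_eventually[OF allI[OF upper]]
        tendsto_const bspec[OF lim h]] .
  then show "\<exists>\<epsilon>\<in>{0<..<1}. (\<lambda>k. INF r\<in>?I \<epsilon> k. ?t k r) \<longlonglongrightarrow> 0"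
    using h by blast
qed

section \<open>Digit structure of the orbit levels\<close>

locale digit_orbit =
  fixes m :: int and \<Lambda> :: "(int \<times> int) set" and z :: "int \<times> int"
  assumes m2: "2 \<le> m"
    and digits: "\<Lambda> \<subseteq> {0..m - 1} \<times> {0..m - 1}"
    and nonempty: "\<Lambda> \<noteq> {}"
begin

abbreviation "L \<equiv> Lambda_iter m m \<Lambda>"
abbreviation "A \<equiv> orbit_plus m m \<Lambda> z"
abbreviation "N \<equiv> card \<Lambda>"
definition "s = log (real_of_int m) (real N)"

lemma finite_digits [simp]: "finite \<Lambda>"
  using digits by (rule finite_subset) auto

lemma N_pos [simp]: "0 < N"
  using nonempty by (simp add: card_gt_0_iff)

lemma N_eq: "real N = real_of_int m powr s"
  using m2 N_pos unfolding s_def by (subst powr_log_cancel) auto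

text \<open>Converts the number of digit strings of length \<open>k\<close> into the
  \<open>s\<close>-th power of the scale \<open>m ^ k\<close>; every appearance of the exponent
  \<open>s\<close> in a count comes from here.\<close>

lemma N_power_eq: "real N ^ k = (real_of_int m ^ k) powr s"
proof -
  have "real N ^ k = real N powr real k" by (simp add: powr_realpow)
  also have "\<dots> = real_of_int m powr (real k * s)" by (simp add: N_eq powr_powr mult.commute)
  also have "\<dots> = (real_of_int m ^ k) powr s" using m2
    by (simp flip: powr_realpow add: powr_powr)
  finally show ?thesis .
qed

lemma s_nonneg: "0 \<le> s"
  using m2 unfolding s_def by (intro zero_le_log_cancel_iff[THEN iffD2]) (auto simp: Suc_le_eq)

lemma L_0 [simp]: "L 0 w = {w}"
  by (auto simp: Lambda_iter_def)

text \<open>Horner's rule: the digits at place 0 are the remainders modulo \<open>m\<close>, and the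
  quotients carry the remaining digits one place lower. The finer structure of the levels is derived
  from this recursion.\<close>

lemma L_Suc: "p \<in> L (Suc k) w \<longleftrightarrow> cell m p \<in> L k w \<and> (fst p mod m, snd p mod m) \<in> \<Lambda>"
proof
  assume "p \<in> L (Suc k) w"
  then obtain i j where p: "p = (m ^ Suc k * fst w + (\<Sum>l<Suc k. i l * m ^ l),
      m ^ Suc k * snd w + (\<Sum>l<Suc k. j l * m ^ l))" and ij: "\<forall>l<Suc k. (i l, j l) \<in> \<Lambda>"
    unfolding Lambda_iter_def by blast
  have e: "m ^ Suc k * v + (\<Sum>l<Suc k. i l * m ^ l)
      = m * (m ^ k * v + (\<Sum>l<k. i (Suc l) * m ^ l)) + i 0" for v and i :: "nat \<Rightarrow> int"
    by (simp only: sum.lessThan_Suc_shift) (simp add: algebra_simps sum_distrib_left)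
  \<comment> \<open>These bounds on the digits let \<open>div\<close> and \<open>mod\<close> recover
    quotient and remainder exactly.\<close>
  have d: "0 \<le> i 0" "i 0 < m" "0 \<le> j 0" "j 0 < m" using ij digits by force+
  have "cell m p = (m ^ k * fst w + (\<Sum>l<k. i (Suc l) * m ^ l),
      m ^ k * snd w + (\<Sum>l<k. j (Suc l) * m ^ l))"
    using d m2 unfolding p e cell_def by simp
  moreover have "(fst p mod m, snd p mod m) = (i 0, j 0)"
    using d m2 unfolding p e by simp
  moreover have "\<forall>l<k. (i (Suc l), j (Suc l)) \<in> \<Lambda>" using ij by simp
  ultimately show "cell m p \<in> L k w \<and> (fst p mod m, snd p mod m) \<in> \<Lambda>"
    unfolding Lambda_iter_def mem_Collect_eq
    using ij exI[of _ "\<lambda>l. i (Suc l)"] exI[of _ "\<lambda>l. j (Suc l)"] by fastforce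
next
  assume a: "cell m p \<in> L k w \<and> (fst p mod m, snd p mod m) \<in> \<Lambda>"
  then obtain i j where p: "cell m p = (m ^ k * fst w + (\<Sum>l<k. i l * m ^ l),
      m ^ k * snd w + (\<Sum>l<k. j l * m ^ l))" and ij: "\<forall>l<k. (i l, j l) \<in> \<Lambda>"
    unfolding Lambda_iter_def by blast
  \<comment> \<open>The remainder becomes the digit at place 0, and the digits of the quotient move
    up one place.\<close>
  define i' where "i' = case_nat (fst p mod m) i"
  define j' where "j' = case_nat (snd p mod m) j"
  have e: "m ^ Suc k * v + (\<Sum>l<Suc k. case_nat c i l * m ^ l)
      = m * (m ^ k * v + (\<Sum>l<k. i l * m ^ l)) + c" for v c and i :: "nat \<Rightarrow> int"
    by (simp only: sum.lessThan_Suc_shift) (simp add: algebra_simps sum_distrib_left)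
  have "p = (m * fst (cell m p) + fst p mod m, m * snd (cell m p) + snd p mod m)"
    by (simp add: cell_def)
  also have "\<dots> = (m ^ Suc k * fst w + (\<Sum>l<Suc k. i' l * m ^ l),
      m ^ Suc k * snd w + (\<Sum>l<Suc k. j' l * m ^ l))"
    unfolding i'_def j'_def e p by simp
  finally have "p = \<dots>" .
  moreover have "\<forall>l<Suc k. (i' l, j' l) \<in> \<Lambda>"
    using ij a by (auto simp: i'_def j'_def split: nat.splits)
  ultimately show "p \<in> L (Suc k) w" unfolding Lambda_iter_def by blast
qed

text \<open>Cuts a digit string at place \<open>l\<close>: the upper part is a point of level
  \<open>k\<close> over \<open>w\<close>, and the lower part is a string of length \<open>l\<close>
  over that point.\<close>

lemma L_add: "p \<in> L (l + k) w \<longleftrightarrow> p \<in> L l (cell (m ^ l) p) \<and> cell (m ^ l) p \<in> L k w"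
proof (induction l arbitrary: p)
  case (Suc l)
  have "cell (m ^ l) (cell m p) = cell (m ^ Suc l) p"
    using m2 by (simp add: cell_cell)
  then show ?case using Suc[of "cell m p"] by (auto simp: L_Suc)
qed simp

lemma L_prefix: "p \<in> L k w \<Longrightarrow> l \<le> k \<Longrightarrow> p \<in> L l (cell (m ^ l) p)"
  using L_add[of p l "k - l" w] by simp

lemma L_cell: "p \<in> L k w \<Longrightarrow> l \<le> k \<Longrightarrow> cell (m ^ l) p \<in> L (k - l) w"
  using L_add[of p l "k - l" w] by simp

lemma L_top: "p \<in> L k w \<Longrightarrow> cell (m ^ k) p = w"
  using L_cell[of p k w k] by simp

text \<open>Appending a lowest digit is inverted by quotient and remainder. Distinct digit strings
  thus give distinct points, and the count is exact.\<close>

lemma card_L: "finite (L k w) \<and> card (L k w) = N ^ k"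
proof (induction k)
  case (Suc k)
  let ?f = "\<lambda>(q, d). (m * fst q + fst d, m * snd q + snd d)"
  have eq: "L (Suc k) w = ?f ` (L k w \<times> \<Lambda>)"
  proof (intro equalityI subsetI)
    fix p assume "p \<in> L (Suc k) w"
    then have "(cell m p, (fst p mod m, snd p mod m)) \<in> L k w \<times> \<Lambda>" by (simp add: L_Suc)
    moreover have "p = ?f (cell m p, (fst p mod m, snd p mod m))" by (simp add: cell_def)
    ultimately show "p \<in> ?f ` (L k w \<times> \<Lambda>)" by blast
  next
    fix p assume "p \<in> ?f ` (L k w \<times> \<Lambda>)"
    then obtain q d where qd: "q \<in> L k w" "d \<in> \<Lambda>"
      "p = (m * fst q + fst d, m * snd q + snd d)" by auto
    moreover have "0 \<le> fst d" "fst d < m" "0 \<le> snd d" "snd d < m" using qd digits by force+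
    ultimately show "p \<in> L (Suc k) w" using m2 by (simp add: L_Suc cell_def)
  qed
  have "inj_on ?f (L k w \<times> \<Lambda>)"
  proof (rule inj_on_inverseI)
    fix x assume x: "x \<in> L k w \<times> \<Lambda>"
    then have "0 \<le> fst (snd x)" "fst (snd x) < m" "0 \<le> snd (snd x)" "snd (snd x) < m"
      using digits by force+
    then show "(\<lambda>p. (cell m p, (fst p mod m, snd p mod m))) (?f x) = x"
      using m2 by (cases x) (simp add: cell_def)
  qed
  then show ?case using Suc by (simp add: eq card_image card_cartesian_product)
qed simp

lemma finite_L [simp]: "finite (L k w)" and card_L' [simp]: "card (L k w) = N ^ k"
  using card_L by auto

lemma L_subset_orbit: "k \<ge> 1 \<Longrightarrow> L k z \<subseteq> A"
  unfolding orbit_plus_def by auto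

lemma orbitE:
  assumes "p \<in> A" obtains k where "p \<in> L k z"
  using assms unfolding orbit_plus_def by auto

section \<open>Upper counting estimates\<close>

text \<open>The fixed rectangle holds the cells of points whose level is at most \<open>j\<close>.
  The summand 5 is 4 for the cells of scale \<open>m ^ l\<close> that meet the square, plus 1 for
  the intermediate levels.\<close>

definition "c0 = real (card ({- \<bar>fst z\<bar>..\<bar>fst z\<bar>} \<times> {- \<bar>snd z\<bar>..\<bar>snd z\<bar>})) + 5"

lemma c0_pos: "c0 > 0"
  unfolding c0_def by (rule add_nonneg_pos[OF of_nat_0_le_iff]) simp

text \<open>A point of level \<open>k\<close> has digits in \<open>\<Lambda>\<close> at the places below \<open>k\<close> and the digits of \<open>z\<close> above,
  so the three parts of the covering set correspond to \<open>k \<ge> l\<close>, \<open>j \<le> k \<le> l\<close> and \<open>k \<le> j\<close>.\<close>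

lemma card_cells_orbit:
  assumes E: "E \<subseteq> A" "E \<subseteq> cubeC x r" "int r \<le> m ^ l" and "j \<le> l"
  shows "real (card (cell (m ^ j) ` E)) \<le> c0 * real (l - j + 1) * real N ^ (l - j)"
proof -
  let ?W = "cell (m ^ l) ` E"
  let ?Z = "{- \<bar>fst z\<bar>..\<bar>fst z\<bar>} \<times> {- \<bar>snd z\<bar>..\<bar>snd z\<bar>}"
  let ?U = "(\<Union>w\<in>?W. L (l - j) w) \<union> (\<Union>i\<in>{..l - j}. L i z) \<union> ?Z"
  have fin: "finite E" using E finite_subset finite_cubeC by blast
  have "cell (m ^ j) ` E \<subseteq> ?U"
  proof
    fix q assume "q \<in> cell (m ^ j) ` E"
    then obtain p where p: "p \<in> E" "q = cell (m ^ j) p" by blast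
    then obtain k where k: "p \<in> L k z" using E orbitE by blast
    consider "l \<le> k" | "k \<le> l" "j \<le> k" | "k \<le> j" using \<open>j \<le> l\<close> by linarith
    then show "q \<in> ?U"
    proof cases
      case 1
      then have "q \<in> L (l - j) (cell (m ^ l) p)"
        using L_cell[OF L_prefix[OF k 1]] p \<open>j \<le> l\<close> by simp
      then show ?thesis using p by blast
    next
      case 2
      then have "q \<in> L (k - j) z" using L_cell[OF k] p by simp
      moreover have "k - j \<in> {..l - j}" using 2 by simp
      ultimately show ?thesis by blast
    next
      case 3
      then have "m ^ j = m ^ k * m ^ (j - k)" by (simp flip: power_add)
      then have "q = cell (m ^ (j - k)) z"
        using L_top[OF k] cell_cell[of "m ^ (j - k)" "m ^ k" p] m2 p by simp
      \<comment> \<open>Division by a positive integer with rounding down does not increase the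
        absolute value: a nonnegative \<open>a\<close> stays between 0 and \<open>a\<close>, a
        negative one between \<open>a\<close> and -1.\<close>
      moreover have "\<bar>a div M\<bar> \<le> \<bar>a\<bar>" if "M > 0" for a M :: int
      proof (cases "a \<ge> 0")
        case True
        then show ?thesis using that using zdiv_mono2[of a 1 M] by (simp add: pos_imp_zdiv_nonneg_iff)
      next
        case False
        then have "a div M < 0" using that by (simp add: neg_imp_zdiv_neg_iff pos_imp_zdiv_neg_iff)
        moreover have "a \<le> a div M"
        proof -
          have "a div 1 \<le> a div M" using that False by (intro zdiv_mono2_neg) auto
          then show ?thesis by simp
        qed
        ultimately show ?thesis by simp
      qed
      ultimately have "\<bar>fst q\<bar> \<le> \<bar>fst z\<bar>" "\<bar>snd q\<bar> \<le> \<bar>snd z\<bar>" using m2 by (auto simp: cell_def)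
      then have "q \<in> ?Z" by (cases q) auto
      then show ?thesis by blast
    qed
  qed
  then have "card (cell (m ^ j) ` E) \<le> card ?U" using fin by (intro card_mono) auto
  also have "\<dots> \<le> card (\<Union>w\<in>?W. L (l - j) w) + card (\<Union>i\<in>{..l - j}. L i z) + card ?Z"
    by (meson add_mono card_Un_le le_refl le_trans)
  also have "card (\<Union>w\<in>?W. L (l - j) w) \<le> (\<Sum>w\<in>?W. card (L (l - j) w))"
    using fin by (intro card_UN_le) auto
  also have "\<dots> = card ?W * N ^ (l - j)" by simp
  also have "card ?W \<le> 4" using E m2 by (intro card_cell_cubeC[of _ r _ x]) auto
  also have "card (\<Union>i\<in>{..l - j}. L i z) \<le> (\<Sum>i\<in>{..l - j}. card (L i z))"
    by (intro card_UN_le) auto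
  \<comment> \<open>Every intermediate level is bounded by the largest one; their number is the
    source of the factor \<open>l - j + 1\<close>.\<close>
  also have "\<dots> \<le> (\<Sum>i\<in>{..l - j}. N ^ (l - j))"
    unfolding card_L' by (intro sum_mono power_increasing) (auto simp: Suc_le_eq)
  finally have "card (cell (m ^ j) ` E) \<le> 4 * N ^ (l - j) + (l - j + 1) * N ^ (l - j) + card ?Z" by simp
  moreover have "1 \<le> N ^ (l - j)" using N_pos by (simp add: Suc_le_eq del: N_pos)
  moreover have "N ^ (l - j) \<le> (l - j + 1) * N ^ (l - j)" by simp
  ultimately have Y: "1 \<le> (l - j + 1) * N ^ (l - j)" "card (cell (m ^ j) ` E) \<le>
      4 * ((l - j + 1) * N ^ (l - j)) + (l - j + 1) * N ^ (l - j) + card ?Z" by linarith+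
  have "card ?Z * 1 \<le> card ?Z * ((l - j + 1) * N ^ (l - j))"
    by (rule mult_le_mono2[OF Y(1)])
  with Y(2) have "card (cell (m ^ j) ` E) \<le> 4 * ((l - j + 1) * N ^ (l - j))
     + (l - j + 1) * N ^ (l - j) + card ?Z * ((l - j + 1) * N ^ (l - j))"
    by linarith
  also have "\<dots> = (card ?Z + 5) * ((l - j + 1) * N ^ (l - j))"
    by (simp only: distrib_right) simp
  finally have "real (card (cell (m ^ j) ` E)) \<le> real ((card ?Z + 5) * ((l - j + 1) * N ^ (l - j)))"
    by (simp only: of_nat_le_iff)
  then show ?thesis by (simp only: c0_def of_nat_mult of_nat_add of_nat_power of_nat_numeral mult.assoc)
qed

text \<open>With \<open>q = N / m powr \<alpha>\<close> below 1, the sequence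
  \<open>t * q ^ t\<close> is bounded, so the gap between \<open>s\<close> and \<alpha> absorbs the
  linear factor.\<close>

lemma polynomial_geometric_bound:
  assumes "s < \<alpha>"
  obtains C where "C > 0"
    "\<forall>t. c0 * real (t + 1) * real N ^ t \<le> C * (real_of_int m ^ t) powr \<alpha>"
proof -
  define q where "q = real N / real_of_int m powr \<alpha>"
  have mp: "real_of_int m > 1" using m2 by simp
  have q: "0 < q" "q < 1"
    using mp powr_less_mono[OF assms mp] N_pos unfolding q_def
    by (simp_all add: N_eq del: N_pos)
  have "(\<lambda>t. real t * q ^ t) \<longlonglongrightarrow> 0"
    using q by (intro powser_times_n_limit_0) auto
  then have "Bseq (\<lambda>t. real t * q ^ t)" by (intro convergent_imp_Bseq) (auto simp: convergent_def)
  then obtain B where B: "\<And>t. norm (real t * q ^ t) \<le> B" "B > 0" by (auto simp: Bseq_def)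
  have B': "real (t + 1) * q ^ t \<le> B + 1" for t
  proof -
    have "q ^ t \<le> 1" using q by (simp add: power_le_one)
    then show ?thesis using B(1)[of t] q by (simp add: algebra_simps)
  qed
  have N: "real N ^ t = q ^ t * (real_of_int m ^ t) powr \<alpha>" for t
  proof -
    have "(real_of_int m ^ t) powr \<alpha> = (real_of_int m powr \<alpha>) ^ t"
      using mp by (simp flip: powr_realpow add: powr_powr mult.commute)
    then show ?thesis using mp by (simp add: q_def power_divide)
  qed
  have "c0 * real (t + 1) * real N ^ t \<le> c0 * (B + 1) * (real_of_int m ^ t) powr \<alpha>" for t
  proof -
    have "c0 * real (t + 1) * real N ^ t = c0 * (real (t + 1) * q ^ t) * (real_of_int m ^ t) powr \<alpha>"
      by (simp only: N mult_ac)
    also have "\<dots> \<le> c0 * (B + 1) * (real_of_int m ^ t) powr \<alpha>"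
      by (intro mult_right_mono mult_left_mono B') (use c0_pos in auto)
    finally show ?thesis .
  qed
  moreover have "c0 * (B + 1) > 0" using c0_pos B by simp
  ultimately show ?thesis using that by blast
qed

text \<open>The common source of all upper bounds. Rounding \<open>r\<close> down to
  \<open>m ^ j\<close> and \<open>2 * R\<close> up to \<open>m ^ l\<close> costs at most a factor
  \<open>m\<close> each, so \<open>m ^ (l - j)\<close> is at most
  \<open>2 * m ^ 2 * (R / r)\<close>.\<close>

lemma card_cells_le:
  assumes "s < \<alpha>"
  obtains C where "C > 0"
    "\<forall>r R E w. 1 \<le> r \<longrightarrow> r \<le> R \<longrightarrow> E \<subseteq> A \<longrightarrow> E \<subseteq> box_pts w R \<longrightarrow>
       (\<exists>M>0. real_of_int M \<le> r \<and> real (card (cell M ` E)) \<le> C * (R / r) powr \<alpha>)"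
proof -
  obtain C where C: "C > 0"
    "\<forall>t. c0 * real (t + 1) * real N ^ t \<le> C * (real_of_int m ^ t) powr \<alpha>"
    using polynomial_geometric_bound[OF assms] by blast
  have \<alpha>: "\<alpha> > 0" using assms s_nonneg by simp
  have mp: "real_of_int m \<ge> 2" using m2 by simp
  show ?thesis
  proof (rule that[of "C * (2 * real_of_int m ^ 2) powr \<alpha>"])
    show "C * (2 * real_of_int m ^ 2) powr \<alpha> > 0" using C mp by simp
    show "\<forall>r R E w. 1 \<le> r \<longrightarrow> r \<le> R \<longrightarrow> E \<subseteq> A \<longrightarrow> E \<subseteq> box_pts w R \<longrightarrow>
       (\<exists>M>0. real_of_int M \<le> r \<and>
         real (card (cell M ` E)) \<le> C * (2 * real_of_int m ^ 2) powr \<alpha> * (R / r) powr \<alpha>)"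
    proof (intro allI impI)
      fix r R E w
      assume rR: "1 \<le> r" "r \<le> R" and E: "E \<subseteq> A" "E \<subseteq> box_pts w R"
      obtain j where j: "real_of_int m ^ j \<le> r" "r < real_of_int m ^ Suc j"
        using power_bracket[OF m2 rR(1)] by blast
      \<comment> \<open>A box of half side \<open>R\<close> has side \<open>2 * R\<close>, so this
        is the length that the larger scale must exceed.\<close>
      obtain l' where l': "real_of_int m ^ l' \<le> 2 * R" "2 * R < real_of_int m ^ Suc l'"
        using power_bracket[OF m2, of "2 * R"] rR by auto
      define l where "l = Suc l'"
      have "real_of_int m ^ j < real_of_int m ^ l" using j l' rR by (simp add: l_def)
      then have jl: "j < l" using mp by (simp add: power_less_imp_less_exp)
      have nat: "real (nat (m ^ l)) = real_of_int m ^ l" using m2 by simp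
      obtain x where x: "box_pts w R \<subseteq> cubeC x (nat (m ^ l))"
        using box_pts_subset_cubeC[of R "nat (m ^ l)" w] l' nat unfolding l_def by auto
      have "real (card (cell (m ^ j) ` E)) \<le> c0 * real (l - j + 1) * real N ^ (l - j)"
        using E x jl m2 by (intro card_cells_orbit[of _ x "nat (m ^ l)"]) auto
      also have "\<dots> \<le> C * (real_of_int m ^ (l - j)) powr \<alpha>" using C(2) by blast
      also have "real_of_int m ^ (l - j) \<le> 2 * real_of_int m ^ 2 * (R / r)"
      proof -
        have "real_of_int m ^ (l - j) * r \<le> real_of_int m ^ (l - j) * real_of_int m ^ Suc j"
          using j mp by (intro mult_left_mono) auto
        also have "\<dots> = real_of_int m ^ l' * real_of_int m ^ 2"
        proof -
          have "l - j + Suc j = l' + 2" using jl by (simp add: l_def)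
          then show ?thesis by (simp only: flip: power_add)
        qed
        also have "\<dots> \<le> 2 * R * real_of_int m ^ 2" using l' by (intro mult_right_mono) auto
        finally show ?thesis using rR by (simp add: field_simps)
      qed
      then have "C * (real_of_int m ^ (l - j)) powr \<alpha> \<le> C * (2 * real_of_int m ^ 2 * (R / r)) powr \<alpha>"
        using C \<alpha> mp by (intro mult_left_mono powr_mono2) auto
      also have "\<dots> = C * (2 * real_of_int m ^ 2) powr \<alpha> * (R / r) powr \<alpha>"
        using rR by (subst powr_mult) (auto simp: powr_mult)
      finally show "\<exists>M>0. real_of_int M \<le> r \<and>
          real (card (cell M ` E)) \<le> C * (2 * real_of_int m ^ 2) powr \<alpha> * (R / r) powr \<alpha>"
        using j m2 by (intro exI[of _ "m ^ j"]) auto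
    qed
  qed
qed

text \<open>At resolution \<open>r = 1\<close> the positive integer \<open>M \<le> r\<close> is 1,
  so counting cells is counting points.\<close>

lemma card_orbit_box:
  assumes "s < \<alpha>"
  obtains C where "C > 0"
    "\<forall>w. \<forall>R\<ge>1. real (card (A \<inter> box_pts w R)) \<le> C * R powr \<alpha>"
proof -
  obtain C where C: "C > 0"
    "\<forall>r R E w. 1 \<le> r \<longrightarrow> r \<le> R \<longrightarrow> E \<subseteq> A \<longrightarrow> E \<subseteq> box_pts w R \<longrightarrow>
       (\<exists>M>0. real_of_int M \<le> r \<and> real (card (cell M ` E)) \<le> C * (R / r) powr \<alpha>)"
    using card_cells_le[OF assms] by blast
  show ?thesis
  proof (rule that[OF C(1)], intro allI impI)
    fix R :: real and w assume "1 \<le> R"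
    then obtain M where M: "M > 0" "real_of_int M \<le> 1"
      "real (card (cell M ` (A \<inter> box_pts w R))) \<le> C * (R / 1) powr \<alpha>"
      using C(2)[rule_format, of 1 R "A \<inter> box_pts w R" w] by blast
    have "M = 1" using M(1,2) by linarith
    then have "cell M ` (A \<inter> box_pts w R) = A \<inter> box_pts w R" by simp
    then show "real (card (A \<inter> box_pts w R)) \<le> C * R powr \<alpha>" using M(3) by simp
  qed
qed

section \<open>Distribution and location of a single level\<close>

text \<open>The Frostman condition, with the exact exponent \<open>s\<close> because only one level
  is counted. The square meets at most four cells of scale \<open>m ^ Suc l\<close>, each with at
  most \<open>N ^ Suc l\<close> points of the level; if \<open>Suc l\<close> exceeds
  \<open>K\<close>, the whole level has no more than that.\<close>

lemma card_L_cubeC: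
  assumes "\<rho> \<ge> 1"
  shows "real (card (L K w \<inter> cubeC x \<rho>)) \<le> 4 * real N * real \<rho> powr s"
proof -
  obtain l where l: "real_of_int m ^ l \<le> real \<rho>" "real \<rho> < real_of_int m ^ Suc l"
    using power_bracket[OF m2, of "real \<rho>"] assms by auto
  have "real_of_int (int \<rho>) < real_of_int (m ^ Suc l)" using l by simp
  then have \<rho>: "int \<rho> \<le> m ^ Suc l" by linarith
  have "card (L K w \<inter> cubeC x \<rho>) \<le> 4 * N ^ Suc l"
  proof (cases "Suc l \<le> K")
    case True
    let ?W = "cell (m ^ Suc l) ` cubeC x \<rho>"
    have "L K w \<inter> cubeC x \<rho> \<subseteq> (\<Union>v\<in>?W. L (Suc l) v)"
      using L_prefix[OF _ True] by blast
    then have "card (L K w \<inter> cubeC x \<rho>) \<le> card (\<Union>v\<in>?W. L (Suc l) v)"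
      by (intro card_mono) auto
    also have "\<dots> \<le> (\<Sum>v\<in>?W. card (L (Suc l) v))" by (intro card_UN_le) auto
    also have "\<dots> = card ?W * N ^ Suc l" by simp
    also have "\<dots> \<le> 4 * N ^ Suc l"
      using m2 \<rho> by (intro mult_right_mono card_cell_cubeC[of _ \<rho> _ x]) auto
    finally show ?thesis .
  next
    case False
    have "card (L K w \<inter> cubeC x \<rho>) \<le> card (L K w)" by (intro card_mono) auto
    also have "\<dots> \<le> N ^ Suc l" unfolding card_L'
      using False N_pos by (intro power_increasing) (auto simp: Suc_le_eq simp del: N_pos)
    finally show ?thesis by simp
  qed
  then have "real (card (L K w \<inter> cubeC x \<rho>)) \<le> real (4 * N ^ Suc l)" by (simp only: of_nat_le_iff)
  also have "\<dots> = 4 * real N * (real_of_int m ^ l) powr s"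
    by (simp flip: N_power_eq)
  also have "\<dots> \<le> 4 * real N * real \<rho> powr s"
    using l s_nonneg m2 by (intro mult_left_mono powr_mono2) auto
  finally show ?thesis .
qed

text \<open>Level \<open>K\<close> lies in the square of side \<open>m ^ K\<close> with corner
  \<open>m ^ K * z\<close>; the summand 1 accounts for the side of that square.\<close>

definition "Zc = \<bar>real_of_int (fst z)\<bar> + \<bar>real_of_int (snd z)\<bar> + 1"

lemma Zc_ge1: "Zc \<ge> 1"
  by (simp add: Zc_def)

lemma L_coords:
  assumes "p \<in> L K w"
  shows "m ^ K * fst w \<le> fst p" "fst p < m ^ K * fst w + m ^ K"
    "m ^ K * snd w \<le> snd p" "snd p < m ^ K * snd w + m ^ K"
proof -
  have e: "fst p div m ^ K = fst w" "snd p div m ^ K = snd w"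
    using L_top[OF assms] by (auto simp: cell_def)
  have "a = m ^ K * (a div m ^ K) + a mod m ^ K \<and> 0 \<le> a mod m ^ K \<and> a mod m ^ K < m ^ K" for a
    using m2 by simp
  from this[of "fst p", unfolded e] this[of "snd p", unfolded e]
  show "m ^ K * fst w \<le> fst p" "fst p < m ^ K * fst w + m ^ K"
    "m ^ K * snd w \<le> snd p" "snd p < m ^ K * snd w + m ^ K" by linarith+
qed

lemma L_subset_box: "L K z \<subseteq> box_pts (0, 0) (Zc * real_of_int m ^ K)"
proof
  fix p assume "p \<in> L K z"
  note c = L_coords[OF this]
  have *: "\<bar>real_of_int a\<bar> \<le> (\<bar>real_of_int b\<bar> + 1) * real_of_int m ^ K"
    if "m ^ K * b \<le> a" "a < m ^ K * b + m ^ K" for a b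
  proof -
    have P: "m ^ K > 0" using m2 by simp
    have "m ^ K * b \<le> m ^ K * \<bar>b\<bar>" "- (m ^ K * b) \<le> m ^ K * \<bar>b\<bar>"
      using P by (simp_all flip: mult_minus_right)
    then have "\<bar>a\<bar> \<le> m ^ K * \<bar>b\<bar> + m ^ K" using that P by linarith
    then have "real_of_int \<bar>a\<bar> \<le> real_of_int (m ^ K * \<bar>b\<bar> + m ^ K)" by (simp only: of_int_le_iff)
    then show ?thesis by (simp add: algebra_simps)
  qed
  have mK: "0 \<le> real_of_int m ^ K" using m2 by simp
  have "(\<bar>real_of_int (fst z)\<bar> + 1) * real_of_int m ^ K \<le> Zc * real_of_int m ^ K"
    "(\<bar>real_of_int (snd z)\<bar> + 1) * real_of_int m ^ K \<le> Zc * real_of_int m ^ K"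
    by (rule mult_right_mono[OF _ mK], simp add: Zc_def)+
  with *[OF c(1,2)] *[OF c(3,4)]
  have "\<bar>real_of_int (fst p)\<bar> \<le> Zc * real_of_int m ^ K" "\<bar>real_of_int (snd p)\<bar> \<le> Zc * real_of_int m ^ K"
    by linarith+
  then show "p \<in> box_pts (0, 0) (Zc * real_of_int m ^ K)"
    unfolding box_pts_def by simp
qed

section \<open>Assouad upper bound, mass and Beurling dimensions\<close>

lemma dim_A_le: "dim_A A \<le> ereal s"
proof (rule ereal_le_of_greater)
  fix \<beta> assume \<beta>: "s < \<beta>"
  obtain C where C: "C > 0"
    "\<forall>r R E w. 1 \<le> r \<longrightarrow> r \<le> R \<longrightarrow> E \<subseteq> A \<longrightarrow> E \<subseteq> box_pts w R \<longrightarrow>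
       (\<exists>M>0. real_of_int M \<le> r \<and> real (card (cell M ` E)) \<le> C * (R / r) powr \<beta>)"
    using card_cells_le[OF \<beta>] by blast
  have "real (cover_num r (A \<inter> {y. emb y \<in> ball (emb x) R})) \<le> C * (R / r) powr \<beta>"
    if rR: "1 \<le> r" "r < R" for x r R
  proof -
    let ?E = "A \<inter> {y. emb y \<in> ball (emb x) R}"
    have sub: "?E \<subseteq> box_pts (emb x) R"
    proof
      fix y assume "y \<in> ?E"
      then have "dist (emb x) (emb y) < R" by simp
      then have "dist (fst (emb x)) (fst (emb y)) < R" "dist (snd (emb x)) (snd (emb y)) < R"
        using dist_fst_le dist_snd_le le_less_trans by blast+
      then show "y \<in> box_pts (emb x) R"
        by (simp add: box_pts_def emb_def dist_real_def abs_minus_commute)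
    qed
    then obtain M where M: "M > 0" "real_of_int M \<le> r" "real (card (cell M ` ?E)) \<le> C * (R / r) powr \<beta>"
      using C(2)[rule_format, OF rR(1) less_imp_le[OF rR(2)] Int_lower1] by blast
    have "cover_num r ?E \<le> card (cell M ` ?E)"
      using finite_subset[OF sub finite_box_pts] M(1,2) by (rule cover_num_le_cells)
    with M(3) show ?thesis by linarith
  qed
  then have "\<beta> \<in> {\<alpha>. \<alpha> \<ge> 0 \<and> (\<exists>C>0. \<forall>x\<in>A. \<forall>r R. 1 \<le> r \<and> r < R \<longrightarrow>
     real (cover_num r (A \<inter> {y. emb y \<in> ball (emb x) R})) \<le> C * (R / r) powr \<alpha>)}"
    using C(1) \<beta> s_nonneg by (auto intro!: exI[of _ C])
  then show "dim_A A \<le> ereal \<beta>" unfolding dim_A_def by (intro Inf_lower imageI)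
qed

lemma dim_Be_le: "dim_Be A \<le> ereal s"
proof (rule ereal_le_of_greater)
  fix \<beta> assume "s < \<beta>"
  \<comment> \<open>Counting with an exponent strictly between \<open>s\<close> and \<beta> leaves
    room to absorb the constant \<open>C\<close> for large \<open>h\<close>, uniformly in the
    centre.\<close>
  then have \<alpha>: "s < (s + \<beta>) / 2" "(s + \<beta>) / 2 < \<beta>" by simp_all
  obtain C where C: "\<forall>w. \<forall>R\<ge>1. real (card (A \<inter> box_pts w R)) \<le> C * R powr ((s + \<beta>) / 2)"
    using card_orbit_box[OF \<alpha>(1)] by blast
  have "eventually (\<lambda>h::real. (SUP w. ln_card (A \<inter> box_pts w h) / ereal (ln h)) \<le> ereal \<beta>) at_top"
    using powr_eventually_dominates[OF \<alpha>(2), of C] eventually_gt_at_top[of 1]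
  proof eventually_elim
    case (elim h)
    show ?case
    proof (rule SUP_least)
      fix w
      have "real (card (A \<inter> box_pts w h)) \<le> C * h powr ((s + \<beta>) / 2)"
        using C[rule_format, of h w] elim(2) by simp
      then have "real (card (A \<inter> box_pts w h)) \<le> h powr \<beta>" using elim(1) by linarith
      then show "ln_card (A \<inter> box_pts w h) / ereal (ln h) \<le> ereal \<beta>"
        by (rule ln_card_ratio_le[OF elim(2)])
    qed
  qed
  then show "dim_Be A \<le> ereal \<beta>" unfolding dim_Be_def by (rule Limsup_bounded)
qed

lemma dim_LM_ge: "ereal s \<le> dim_LM A"
proof (rule ereal_ge_of_less)
  fix \<beta> assume \<beta>: "\<beta> < s"
  have mp: "real_of_int m \<ge> 2" using m2 by simp
  have "eventually (\<lambda>h::real. ereal \<beta> \<le> ln_card (A \<inter> box_pts (0, 0) h) / ereal (ln h)) at_top"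
    using powr_eventually_dominates[OF \<beta>, of "(Zc * real_of_int m) powr s"]
      eventually_gt_at_top[of 1] eventually_ge_at_top[of "Zc * real_of_int m"]
  proof eventually_elim
    case (elim h)
    have Zm: "Zc * real_of_int m \<ge> 2" using mult_mono[of 1 Zc 2 "real_of_int m"] Zc_ge1 mp by simp
    have hZ: "real_of_int m \<le> h / Zc" using elim(3) Zc_ge1 by (simp add: field_simps)
    \<comment> \<open>The largest level whose enclosing box of half side \<open>Zc * m ^ k\<close>
      fits into half side \<open>h\<close>. The bound \<open>hZ\<close> makes it at least 1, the
      first level of the orbit.\<close>
    then obtain k where k: "real_of_int m ^ k \<le> h / Zc" "h / Zc < real_of_int m ^ Suc k"
      using power_bracket[OF m2, of "h / Zc"] mp by auto
    have k1: "k \<ge> 1" using k(2) hZ by (cases k) auto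
    have "Zc * real_of_int m ^ k \<le> h" using k(1) Zc_ge1 by (simp add: field_simps)
    then have "box_pts (0, 0) (Zc * real_of_int m ^ k) \<subseteq> box_pts (0, 0) h"
      by (auto simp: box_pts_def)
    then have "L k z \<subseteq> A \<inter> box_pts (0, 0) h"
      using L_subset_box[of k] L_subset_orbit[OF k1] by blast
    then have card: "N ^ k \<le> card (A \<inter> box_pts (0, 0) h)"
      using card_mono[of "A \<inter> box_pts (0, 0) h" "L k z"] by simp
    have "(Zc * real_of_int m) powr s * h powr \<beta> \<le> h powr s" by (rule elim(1))
    also have "h \<le> Zc * real_of_int m * real_of_int m ^ k" using k(2) Zc_ge1 by (simp add: field_simps)
    then have "h powr s \<le> (Zc * real_of_int m * real_of_int m ^ k) powr s"
      using elim(2) s_nonneg by (intro powr_mono2) auto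
    also have "\<dots> = (Zc * real_of_int m) powr s * (real_of_int m ^ k) powr s" by (rule powr_mult)
    finally have "h powr \<beta> \<le> (real_of_int m ^ k) powr s"
      by (rule mult_left_le_imp_le) (use Zm in auto)
    also have "\<dots> = real (N ^ k)" by (simp flip: N_power_eq)
    also have "\<dots> \<le> real (card (A \<inter> box_pts (0, 0) h))" using card by (simp only: of_nat_le_iff)
    finally show ?case by (rule ln_card_ratio_ge[OF elim(2)])
  qed
  then show "ereal \<beta> \<le> dim_LM A" unfolding dim_LM_def by (rule Liminf_bounded)
qed

lemma dim_LM_eq: "dim_LM A = ereal s"
  and dim_UM_eq: "dim_UM A = ereal s"
  and dim_Be_eq: "dim_Be A = ereal s"
proof -
  note c = dim_LM_ge dim_LM_le_UM[of A] dim_UM_le_Be[of A] dim_Be_le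
  show "dim_LM A = ereal s"
    by (rule antisym[OF order_trans[OF c(2) order_trans[OF c(3,4)]] c(1)])
  show "dim_UM A = ereal s"
    by (rule antisym[OF order_trans[OF c(3,4)] order_trans[OF c(1,2)]])
  show "dim_Be A = ereal s"
    by (rule antisym[OF c(4) order_trans[OF order_trans[OF c(1,2)] c(3)]])
qed

lemma dim_M_eq: "dim_M A = ereal s"
  unfolding dim_M_def by (rule the_equality) (auto simp: dim_LM_eq dim_UM_eq)

section \<open>Discrete Hausdorff dimensions\<close>

text \<open>Unit cubes suffice as a cover: the shell of index \<open>k\<close> has at most
  \<open>C * 2 ^ k powr \<alpha>\<close> points with \<alpha> below \<beta>, each of cost
  \<open>2 ^ k powr (- \<beta>)\<close>, so the costs are dominated by a geometric series.\<close>

lemma dim_DH_le: "dim_DH A \<le> ereal s"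
proof (rule ereal_le_of_greater)
  fix \<beta> assume "s < \<beta>"
  define \<alpha> where "\<alpha> = (s + \<beta>) / 2"
  have \<alpha>: "s < \<alpha>" "\<alpha> < \<beta>" using \<open>s < \<beta>\<close> by (simp_all add: \<alpha>_def)
  obtain C where C: "C > 0" "\<forall>w. \<forall>R\<ge>1. real (card (A \<inter> box_pts w R)) \<le> C * R powr \<alpha>"
    using card_orbit_box[OF \<alpha>(1)] by blast
  have bound: "nu \<beta> A (S2 (Suc k)) \<le> C * (2 powr (\<alpha> - \<beta>)) ^ Suc k" for k
  proof -
    have "A \<inter> S2 (Suc k) \<subseteq> (\<Union>x\<in>A \<inter> S2 (Suc k). cubeC x 1)" by (auto simp: cubeC_def)
    then have "nu \<beta> A (S2 (Suc k)) \<le>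
        real (card (A \<inter> S2 (Suc k))) * (real 1 / real (diam_cube (S2 (Suc k)))) powr \<beta>"
      using \<alpha> s_nonneg by (intro nu_le_cubes[where f = "\<lambda>x. x"]) auto
    also have "card (A \<inter> S2 (Suc k)) \<le> card (A \<inter> box_pts (0, 0) (2 ^ Suc k))"
      using S2_subset_V2[of "Suc k"] V2_subset_box_pts[of "Suc k"] by (intro card_mono) auto
    then have "real (card (A \<inter> S2 (Suc k))) \<le> C * (2 ^ Suc k) powr \<alpha>"
      using C(2)[rule_format, of "2 ^ Suc k" "(0, 0)"] one_le_power[of "2::real" "Suc k"] by linarith
    then have "real (card (A \<inter> S2 (Suc k))) * (real 1 / real (diam_cube (S2 (Suc k)))) powr \<beta>
        \<le> C * (2 ^ Suc k) powr \<alpha> * (1 / 2 ^ Suc k) powr \<beta>"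
      unfolding diam_S2 by (intro mult_mono) (use C(1) in auto)
    also have "\<dots> = C * (2 powr (\<alpha> - \<beta>)) ^ Suc k"
    proof -
      have "(2::real) ^ Suc k = 2 powr real (Suc k)" by (rule powr_realpow[symmetric]) simp
      then have "((2::real) ^ Suc k) powr \<alpha> * (1 / 2 ^ Suc k) powr \<beta>
          = 2 powr (real (Suc k) * \<alpha>) * 2 powr (- (real (Suc k) * \<beta>))"
        by (simp only: powr_minus_divide[symmetric] powr_powr mult_minus_left)
      also have "\<dots> = (2 powr (\<alpha> - \<beta>)) powr real (Suc k)"
        unfolding powr_powr powr_add[symmetric] by (simp add: algebra_simps)
      also have "\<dots> = (2 powr (\<alpha> - \<beta>)) ^ Suc k" by (rule powr_realpow) simp
      finally show ?thesis by (simp only: mult.assoc)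
    qed
    finally show ?thesis .
  qed
  have q: "2 powr (\<alpha> - \<beta>) < 1" using \<alpha> by (simp add: powr_less_one)
  have "summable (\<lambda>k. nu \<beta> A (S2 (Suc k)))"
  proof (rule summable_comparison_test')
    show "summable (\<lambda>k. C * (2 powr (\<alpha> - \<beta>)) ^ Suc k)"
      using q by (intro summable_mult) (simp add: summable_Suc_iff summable_geometric)
    show "norm (nu \<beta> A (S2 (Suc k))) \<le> C * (2 powr (\<alpha> - \<beta>)) ^ Suc k" if "k \<ge> 0" for k
      using bound[of k] nu_nonneg[of A "S2 (Suc k)" \<beta>] by simp
  qed
  then have "\<beta> \<in> {\<alpha>. \<alpha> > 0 \<and> summable (\<lambda>k. nu \<alpha> A (S2 (Suc k)))}"
    using \<alpha> s_nonneg by simp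
  then show "dim_DH A \<le> ereal \<beta>" unfolding dim_DH_def by (intro Inf_lower imageI)
qed

text \<open>Mass distribution principle for counting measure on level \<open>K\<close>: a cube of a
  cover carries at most a constant times its cost, and summing over the cover bounds the total
  mass.\<close>

lemma card_level_shell_le_nu:
  assumes "K \<ge> 1" "0 \<le> \<alpha>" "\<alpha> \<le> s"
  shows "real (card (L K z \<inter> S2 (Suc i))) \<le> 4 * real N * (2 ^ Suc i) powr s * nu \<alpha> A (S2 (Suc i))"
proof -
  define D :: nat where "D = 2 ^ Suc i"
  define E where "E = L K z \<inter> S2 (Suc i)"
  define c where "c = 4 * real N * real D powr s"
  have D: "D > 0" "real D = 2 ^ Suc i" by (simp_all add: D_def)
  have c: "c > 0" using N_pos D by (simp add: c_def)
  have [simp]: "finite E" by (simp add: E_def)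
  have piece: "real (card (E \<inter> U)) \<le> c * (real (diam_cube U) / real D) powr \<alpha>" if "U \<in> cubes" for U
  proof -
    have "finite U" using that by (auto simp: cubes_def)
    then obtain y where y: "diam_cube U > 0" "U \<subseteq> cubeC y (diam_cube U)" by (rule diam_cube_cover)
    show ?thesis
    proof (cases "diam_cube U \<le> D")
      case True
      have "card (E \<inter> U) \<le> card (L K z \<inter> cubeC y (diam_cube U))"
        using y by (intro card_mono) (auto simp: E_def)
      then have "real (card (E \<inter> U)) \<le> 4 * real N * real (diam_cube U) powr s"
        using card_L_cubeC[of "diam_cube U" K z y] y(1) by linarith
      also have "real (diam_cube U) powr s = real D powr s * (real (diam_cube U) / real D) powr s"
        using D by (simp add: powr_divide)
      also have "4 * real N * \<dots> = c * (real (diam_cube U) / real D) powr s" by (simp add: c_def)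
      \<comment> \<open>The ratio of sides is at most 1, so lowering the exponent from
        \<open>s\<close> to \<alpha> increases the power.\<close>
      also have "\<dots> \<le> c * (real (diam_cube U) / real D) powr \<alpha>"
        using c D True assms by (intro mult_left_mono powr_mono') auto
      finally show ?thesis .
    next
      case False
      \<comment> \<open>A cube larger than the shell carries no more than all of \<open>E\<close>,
        which lies in one cube of side \<open>D\<close>, while its cost is at least 1.\<close>
      have "E \<subseteq> L K z \<inter> cubeC (- (2 ^ i), - (2 ^ i)) D"
        using S2_subset_V2[of "Suc i"] unfolding E_def D_def V2_Suc by blast
      then have "card (E \<inter> U) \<le> card (L K z \<inter> cubeC (- (2 ^ i), - (2 ^ i)) D)"
        by (intro card_mono) auto
      then have "real (card (E \<inter> U)) \<le> c"
        using card_L_cubeC[of D K z "(- (2 ^ i), - (2 ^ i))"] D(1) unfolding c_def by linarith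
      also have "1 \<le> (real (diam_cube U) / real D) powr \<alpha>"
        using False D assms by (intro ge_one_powr_ge_zero) auto
      then have "c \<le> c * (real (diam_cube U) / real D) powr \<alpha>" using c by simp
      finally show ?thesis .
    qed
  qed
  have "real (card E) / c \<le> nu \<alpha> A (S2 (Suc i))"
  proof (rule nu_greatest)
    fix \<U> assume \<U>: "finite \<U>" "\<U> \<subseteq> cubes" "A \<inter> S2 (Suc i) \<subseteq> \<Union>\<U>"
    have "E \<subseteq> (\<Union>U\<in>\<U>. E \<inter> U)" using \<U>(3) L_subset_orbit[OF assms(1)] by (auto simp: E_def)
    then have "card E \<le> card (\<Union>U\<in>\<U>. E \<inter> U)" using \<U>(1) by (intro card_mono) auto
    also have "\<dots> \<le> (\<Sum>U\<in>\<U>. card (E \<inter> U))" using \<U>(1) by (intro card_UN_le) auto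
    finally have "real (card E) \<le> (\<Sum>U\<in>\<U>. real (card (E \<inter> U)))"
      by (simp only: of_nat_le_iff flip: of_nat_sum)
    also have "\<dots> \<le> (\<Sum>U\<in>\<U>. c * (real (diam_cube U) / real D) powr \<alpha>)"
      using piece \<U>(2) by (intro sum_mono) blast
    also have "\<dots> = c * (\<Sum>U\<in>\<U>. (real (diam_cube U) / real D) powr \<alpha>)"
      by (simp add: sum_distrib_left)
    finally show "real (card E) / c \<le> (\<Sum>U\<in>\<U>. (real (diam_cube U) / real (diam_cube (S2 (Suc i)))) powr \<alpha>)"
      using c unfolding diam_S2 D_def[symmetric] by (simp add: divide_le_eq mult.commute)
  qed simp
  then show ?thesis using c unfolding E_def c_def D(2) by (simp add: divide_le_eq mult.commute)
qed

text \<open>Adds up the shell bounds beyond \<open>k0\<close>. The factor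
  \<open>2 powr s / (2 powr s - 1)\<close> is the sum of the geometric series of ratio
  \<open>2 powr (- s)\<close>, and \<open>V2 k0\<close> takes in the shells where \<open>nu\<close>
  is not yet controlled.\<close>

lemma card_level_V2_le:
  assumes "K \<ge> 1" "0 \<le> \<alpha>" "\<alpha> \<le> s" "s > 0" "k0 \<le> k"
    and nu: "\<And>k. k \<ge> k0 \<Longrightarrow> nu \<alpha> A (S2 k) \<le> \<eta>"
  shows "real (card (L K z \<inter> V2 k)) \<le>
    real (card (V2 k0)) + 4 * real N * \<eta> * (2 powr s / (2 powr s - 1)) * (2 ^ k) powr s"
  using \<open>k0 \<le> k\<close>
proof (induction k rule: dec_induct)
  case base
  have "0 \<le> \<eta>" using nu[of k0] nu_nonneg[of A "S2 k0" \<alpha>] by simp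
  moreover have "2 powr s > 1" using \<open>s > 0\<close> by simp
  ultimately have "0 \<le> 4 * real N * \<eta> * (2 powr s / (2 powr s - 1)) * (2 ^ k0) powr s" by simp
  moreover have "card (L K z \<inter> V2 k0) \<le> card (V2 k0)" by (intro card_mono) auto
  ultimately show ?case by linarith
next
  case (step k)
  define q where "q = 2 powr s"
  define x where "x = ((2::real) ^ k) powr s"
  have q: "q > 1" using \<open>s > 0\<close> by (simp add: q_def)
  have x: "((2::real) ^ Suc k) powr s = q * x"
    unfolding q_def x_def power_Suc by (rule powr_mult)
  have "card (L K z \<inter> V2 (Suc k)) \<le> card ((L K z \<inter> V2 k) \<union> (L K z \<inter> S2 (Suc k)))"
    using V2_Suc_subset[of k] by (intro card_mono) auto
  also have "\<dots> \<le> card (L K z \<inter> V2 k) + card (L K z \<inter> S2 (Suc k))" by (rule card_Un_le)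
  finally have "real (card (L K z \<inter> V2 (Suc k))) \<le>
      real (card (L K z \<inter> V2 k)) + real (card (L K z \<inter> S2 (Suc k)))" by linarith
  moreover have "real (card (L K z \<inter> S2 (Suc k))) \<le> 4 * real N * (q * x) * \<eta>"
  proof -
    have "real (card (L K z \<inter> S2 (Suc k))) \<le> 4 * real N * (q * x) * nu \<alpha> A (S2 (Suc k))"
      using card_level_shell_le_nu[OF assms(1-3), of k] unfolding x .
    also have "\<dots> \<le> 4 * real N * (q * x) * \<eta>"
      using nu[of "Suc k"] step.hyps q by (intro mult_left_mono) (auto simp: x_def)
    finally show ?thesis .
  qed
  moreover have "4 * real N * \<eta> * (q / (q - 1)) * x + 4 * real N * (q * x) * \<eta>
      = 4 * real N * \<eta> * (q / (q - 1)) * (q * x)"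
    using q by (simp add: field_simps)
  ultimately show ?case using step.IH unfolding x q_def[symmetric] x_def[symmetric] by linarith
qed

text \<open>The points of level \<open>K\<close> number \<open>N ^ K\<close>, whereas small \<open>nu\<close> on all late shells would leave
  room for at most half of them outside a fixed cube.\<close>

lemma nu_tendsto_0_imp_ge:
  assumes "0 \<le> \<alpha>" and lim: "(\<lambda>k. nu \<alpha> A (S2 k)) \<longlonglongrightarrow> 0"
  shows "s \<le> \<alpha>"
proof (rule ccontr)
  assume "\<not> s \<le> \<alpha>"
  then have s: "s > 0" "\<alpha> \<le> s" using assms(1) by simp_all
  have mp: "real_of_int m \<ge> 2" using m2 by simp
  have q: "2 powr s > 1" using s by simp
  have N1: "real N > 1" unfolding N_eq using mp s by (intro gr_one_powr) auto
  \<comment> \<open>Collects the constants of \<open>card_level_V2_le\<close> and the factor from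
    the size of the dyadic cube, so that the threshold \<open>1 / (2 * T)\<close> leaves exactly
    half of \<open>N ^ K\<close>.\<close>
  define T where "T = 4 * real N * (2 powr s / (2 powr s - 1)) * (4 * Zc) powr s"
  have T: "T > 0" using q N_pos Zc_ge1 by (simp add: T_def)
  have "eventually (\<lambda>k. nu \<alpha> A (S2 k) < 1 / (2 * T)) sequentially"
    using T by (intro order_tendstoD(2)[OF lim]) simp
  then obtain k0 where k0: "\<And>k. k \<ge> k0 \<Longrightarrow> nu \<alpha> A (S2 k) \<le> 1 / (2 * T)"
    unfolding eventually_sequentially using less_imp_le by blast
  have *: "real N ^ K \<le> 2 * real (card (V2 k0))" if K: "K \<ge> 1" "K \<ge> k0" for K
  proof -
    have mK: "1 \<le> real_of_int m ^ K" using mp by (intro one_le_power) simp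
    have ZK: "real_of_int m ^ K \<le> Zc * real_of_int m ^ K" using Zc_ge1 mK by simp
    \<comment> \<open>A box of half side below \<open>2 ^ Suc i\<close> lies in
      \<open>V2 (Suc (Suc i))\<close>, whose side is at most \<open>4 * Zc * m ^ K\<close>.\<close>
    obtain i where i: "real_of_int 2 ^ i \<le> Zc * real_of_int m ^ K" "Zc * real_of_int m ^ K < real_of_int 2 ^ Suc i"
      using power_bracket[OF order_refl order_trans[OF mK ZK]] by blast
    \<comment> \<open>Forces \<open>i\<close> to grow with \<open>K\<close>, so that the dyadic cube
      reaches beyond index \<open>k0\<close>.\<close>
    have "(2::real) ^ K \<le> real_of_int m ^ K" using mp by (intro power_mono) auto
    then have "(2::real) ^ K < 2 ^ Suc i" using i(2) ZK by simp
    then have "K < Suc i" by (rule power_less_imp_less_exp[rotated]) simp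
    then have ki: "k0 \<le> Suc (Suc i)" using K by simp
    have "L K z \<subseteq> V2 (Suc (Suc i))"
      using L_subset_box[of K] box_pts_subset_V2[of _ "Suc i"] i(2) by fastforce
    then have "L K z \<inter> V2 (Suc (Suc i)) = L K z" by blast
    then have "real N ^ K \<le> real (card (V2 k0))
        + 4 * real N * (1 / (2 * T)) * (2 powr s / (2 powr s - 1)) * (2 ^ Suc (Suc i)) powr s"
      using card_level_V2_le[OF K(1) assms(1) s(2,1) ki k0] by simp
    also have "(2 ^ Suc (Suc i)) powr s \<le> (4 * Zc * real_of_int m ^ K) powr s"
      using i(1) s by (intro powr_mono2) auto
    then have "4 * real N * (1 / (2 * T)) * (2 powr s / (2 powr s - 1)) * (2 ^ Suc (Suc i)) powr s
      \<le> 4 * real N * (1 / (2 * T)) * (2 powr s / (2 powr s - 1)) * (4 * Zc * real_of_int m ^ K) powr s"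
      using T q by (intro mult_left_mono) auto
    also have "(4 * Zc * real_of_int m ^ K) powr s = (4 * Zc) powr s * real N ^ K"
      unfolding N_power_eq by (rule powr_mult)
    also have "4 * real N * (1 / (2 * T)) * (2 powr s / (2 powr s - 1)) * ((4 * Zc) powr s * real N ^ K)
      = T / (2 * T) * real N ^ K"
      unfolding T_def
      by (simp only: mult_ac times_divide_eq_left times_divide_eq_right mult_1_right mult_1_left)
    also have "\<dots> = real N ^ K / 2" using T by simp
    finally show ?thesis by simp
  qed
  obtain n where "2 * real (card (V2 k0)) < real N ^ n" using N1 real_arch_pow by blast
  also have "\<dots> \<le> real N ^ (max n (max 1 k0))" using N1 by (intro power_increasing) auto
  also have "\<dots> \<le> 2 * real (card (V2 k0))" by (rule *) auto
  finally show False by simp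
qed

lemma dim_LH_ge: "ereal s \<le> dim_LH A"
  unfolding dim_LH_def by (rule Inf_greatest) (auto intro!: nu_tendsto_0_imp_ge)

section \<open>Lower entropy index and packing dimension\<close>

text \<open>The comparison \<open>nu_le_pack_num\<close> has a constant independent of
  \<open>r\<close>, so it passes to the infimum over \<open>r\<close>; if these infima vanish in the
  limit, so does \<open>nu\<close>.\<close>

lemma lower_entropy_index_ge: "ereal s \<le> lower_entropy_index A"
  unfolding lower_entropy_index_def
proof (rule Inf_greatest, clarify)
  fix \<alpha> \<epsilon> :: real
  let ?I = "\<lambda>k::nat. {1..2 powr (real k * (1 - \<epsilon>))}"
  let ?f = "\<lambda>k. INF r\<in>?I k. (r / 2 ^ k) powr \<alpha> * real (pack_num r (A \<inter> S2 k))"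
  assume a: "0 \<le> \<alpha>" "\<epsilon> \<in> {0<..<1}" and lim: "?f \<longlonglongrightarrow> 0"
  have "nu \<alpha> A (S2 (Suc i)) / 3 powr \<alpha> \<le> ?f (Suc i)" for i
  proof (rule cINF_greatest)
    have "2 powr (real (Suc i) * (1 - \<epsilon>)) \<ge> 1" using a(2) by (intro ge_one_powr_ge_zero) auto
    then show "?I (Suc i) \<noteq> {}" by simp
    fix r assume "r \<in> ?I (Suc i)"
    then show "nu \<alpha> A (S2 (Suc i)) / 3 powr \<alpha> \<le> (r / 2 ^ Suc i) powr \<alpha> * real (pack_num r (A \<inter> S2 (Suc i)))"
      using nu_le_pack_num[of r \<alpha> A i] a(1) by (simp add: divide_le_eq mult.commute)
  qed
  then have up: "nu \<alpha> A (S2 (Suc i)) \<le> 3 powr \<alpha> * ?f (Suc i)" for i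
    by (simp add: divide_le_eq mult.commute)
  have "(\<lambda>i. 3 powr \<alpha> * ?f (Suc i)) \<longlonglongrightarrow> 3 powr \<alpha> * 0"
    by (intro tendsto_intros LIMSEQ_Suc lim)
  then have lim': "(\<lambda>i. 3 powr \<alpha> * ?f (Suc i)) \<longlonglongrightarrow> 0" by simp
  have "(\<lambda>i. nu \<alpha> A (S2 (Suc i))) \<longlonglongrightarrow> 0"
    by (rule tendsto_sandwich[OF _ _ tendsto_const lim'])
      (use up in \<open>auto intro!: always_eventually nu_nonneg\<close>)
  then have "(\<lambda>k. nu \<alpha> A (S2 k)) \<longlonglongrightarrow> 0" by (rule LIMSEQ_imp_Suc)
  with a(1) show "ereal s \<le> ereal \<alpha>" by (simp add: nu_tendsto_0_imp_ge)
qed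

text \<open>Cells are counted with an exponent \<alpha> between \<open>s\<close> and \<beta>. Since
  \<epsilon> keeps \<open>r / 2 ^ k\<close> below \<open>2 powr (- (k * \<epsilon>))\<close>, the
  surplus \<open>\<beta> - \<alpha>\<close> gives geometric decay uniformly in
  \<open>r\<close>.\<close>

lemma pack_num_bound:
  assumes "s < \<beta>" "0 < \<epsilon>" "\<epsilon> < 1"
  obtains C q where "0 \<le> q" "q < 1"
    "\<forall>k::nat. \<forall>r\<in>{1..2 powr (real k * (1 - \<epsilon>))}.
       (r / 2 ^ k) powr \<beta> * real (pack_num r (A \<inter> S2 k)) \<le> C * q ^ k"
proof -
  define \<alpha> where "\<alpha> = (s + \<beta>) / 2"
  have \<alpha>: "s < \<alpha>" "\<alpha> < \<beta>" using \<open>s < \<beta>\<close> by (simp_all add: \<alpha>_def)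
  obtain C where C: "C > 0"
    "\<forall>r R E w. 1 \<le> r \<longrightarrow> r \<le> R \<longrightarrow> E \<subseteq> A \<longrightarrow> E \<subseteq> box_pts w R \<longrightarrow>
       (\<exists>M>0. real_of_int M \<le> r \<and> real (card (cell M ` E)) \<le> C * (R / r) powr \<alpha>)"
    using card_cells_le[OF \<alpha>(1)] by blast
  define q where "q = 2 powr (- (\<epsilon> * (\<beta> - \<alpha>)))"
  have q: "0 \<le> q" "q < 1" using assms \<alpha> by (auto simp: q_def powr_less_one)
  have "(r / 2 ^ k) powr \<beta> * real (pack_num r (A \<inter> S2 k)) \<le> C * q ^ k"
    if r: "1 \<le> r" "r \<le> 2 powr (real k * (1 - \<epsilon>))" for r and k :: nat
  proof -
    have two: "(2::real) ^ k = 2 powr real k" by (simp add: powr_realpow)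
    have "real k * (1 - \<epsilon>) \<le> real k" using assms by (simp add: mult_left_le)
    then have "2 powr (real k * (1 - \<epsilon>)) \<le> 2 powr real k" by simp
    then have rk: "r \<le> 2 ^ k" using r(2) two by linarith
    have "A \<inter> S2 k \<subseteq> box_pts (0, 0) (2 ^ k)" using S2_subset_V2[of k] V2_subset_box_pts[of k] by blast
    then obtain M where M: "M > 0" "real_of_int M \<le> r"
      "real (card (cell M ` (A \<inter> S2 k))) \<le> C * (2 ^ k / r) powr \<alpha>"
      using C(2)[rule_format, OF r(1) rk Int_lower1] by blast
    have "pack_num r (A \<inter> S2 k) \<le> card (cell M ` (A \<inter> S2 k))"
      using M by (intro pack_num_le_cells) auto
    then have "real (pack_num r (A \<inter> S2 k)) \<le> C * (2 ^ k / r) powr \<alpha>" using M(3) by linarith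
    then have "(r / 2 ^ k) powr \<beta> * real (pack_num r (A \<inter> S2 k)) \<le> (r / 2 ^ k) powr \<beta> * (C * (2 ^ k / r) powr \<alpha>)"
      by (intro mult_left_mono) auto
    also have "(2 ^ k / r) powr \<alpha> = (r / 2 ^ k) powr (- \<alpha>)"
      using r by (simp add: powr_minus powr_divide field_simps)
    also have "(r / 2 ^ k) powr \<beta> * (C * (r / 2 ^ k) powr (- \<alpha>)) = C * (r / 2 ^ k) powr (\<beta> - \<alpha>)"
      by (simp add: powr_add[of _ \<beta> "- \<alpha>", simplified])
    also have "\<dots> \<le> C * (2 powr (- (real k * \<epsilon>))) powr (\<beta> - \<alpha>)"
    proof -
      have "r / 2 ^ k \<le> 2 powr (real k * (1 - \<epsilon>)) / 2 powr real k"
        unfolding two using r by (intro divide_right_mono) auto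
      also have "\<dots> = 2 powr (- (real k * \<epsilon>))" by (simp add: powr_diff[symmetric] algebra_simps)
      finally show ?thesis using C(1) r \<alpha> by (intro mult_left_mono powr_mono2) auto
    qed
    also have "(2 powr (- (real k * \<epsilon>))) powr (\<beta> - \<alpha>) = q powr real k"
      unfolding q_def powr_powr by (simp add: algebra_simps)
    also have "q powr real k = q ^ k" by (rule powr_realpow) (simp add: q_def)
    finally show ?thesis .
  qed
  then have "\<forall>k::nat. \<forall>r\<in>{1..2 powr (real k * (1 - \<epsilon>))}.
       (r / 2 ^ k) powr \<beta> * real (pack_num r (A \<inter> S2 k)) \<le> C * q ^ k" by simp
  then show ?thesis by (rule that[OF q])
qed

lemma dim_DP_le: "dim_DP A \<le> ereal s"
proof (rule ereal_le_of_greater)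
  fix \<beta> assume \<beta>: "s < \<beta>"
  let ?t = "\<lambda>k r. (r / 2 ^ k) powr \<beta> * real (pack_num r (A \<inter> S2 k))"
  let ?I = "\<lambda>\<epsilon> k::nat. {1..2 powr (real k * (1 - \<epsilon>))}"
  have "(\<lambda>k. SUP r\<in>?I \<epsilon> k. ?t k r) \<longlonglongrightarrow> 0" if "\<epsilon> \<in> {0<..<1}" for \<epsilon>
  proof -
    have "0 < \<epsilon>" "\<epsilon> < 1" using that by auto
    then obtain C q where q: "0 \<le> q" "q < 1" and
      C: "\<forall>k::nat. \<forall>r\<in>?I \<epsilon> k. ?t k r \<le> C * q ^ k"
      by (rule pack_num_bound[OF \<beta>])
    have one: "1 \<in> ?I \<epsilon> k" for k
      using \<open>\<epsilon> < 1\<close> ge_one_powr_ge_zero[of 2 "real k * (1 - \<epsilon>)"] by simp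
    have t0: "0 \<le> ?t k r" for k r by simp
    have ba: "bdd_above (?t k ` ?I \<epsilon> k)" for k by (rule bdd_aboveI2[of _ _ "C * q ^ k"]) (use C in blast)
    have upper: "(SUP r\<in>?I \<epsilon> k. ?t k r) \<le> C * q ^ k" for k
      by (rule cSUP_least) (use one C in blast)+
    have lower: "0 \<le> (SUP r\<in>?I \<epsilon> k. ?t k r)" for k
      by (rule cSUP_upper2[OF ba one t0])
    have "(\<lambda>k. C * q ^ k) \<longlonglongrightarrow> C * 0" using q by (intro tendsto_intros LIMSEQ_power_zero) auto
    then have lim: "(\<lambda>k. C * q ^ k) \<longlonglongrightarrow> 0" by simp
    show ?thesis
      using tendsto_sandwich[OF always_eventually[OF allI[OF lower]] always_eventually[OF allI[OF upper]]
          tendsto_const lim] .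
  qed
  then show "dim_DP A \<le> ereal \<beta>"
    unfolding dim_DP_def using \<beta> s_nonneg by (intro Inf_lower imageI) simp
qed

section \<open>Assouad lower bound and conclusion\<close>

text \<open>Tested at \<open>r = 1\<close> on balls that contain a whole level: \<open>N ^ K\<close>
  points need at least a quarter as many unit squares, which excludes exponents below
  \<open>s\<close> as \<open>K\<close> grows.\<close>

lemma dim_A_ge: "ereal s \<le> dim_A A"
  unfolding dim_A_def
proof (rule Inf_greatest, clarify)
  fix \<alpha> C :: real
  assume a: "0 \<le> \<alpha>" "0 < C" and C: "\<forall>x\<in>A. \<forall>r R. 1 \<le> r \<and> r < R \<longrightarrow>
     real (cover_num r (A \<inter> {y. emb y \<in> ball (emb x) R})) \<le> C * (R / r) powr \<alpha>"
  have mp: "real_of_int m \<ge> 2" using m2 by simp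
  define C' where "C' = 4 * (C * 2 powr \<alpha>)"
  have *: "(real_of_int m powr (s - \<alpha>)) ^ K \<le> C'" if "K \<ge> 1" for K
  proof -
    define M where "M = real_of_int m ^ K"
    have M: "M \<ge> 1" using mp by (auto simp: M_def intro: one_le_power)
    have "L K z \<noteq> {}" using card_L'[of K z] N_pos by (metis card.empty power_eq_0_iff less_numeral_extra(3))
    then obtain x where x: "x \<in> L K z" by blast
    \<comment> \<open>Points of level \<open>K\<close> differ by less than \<open>M\<close> in each
      coordinate, so their Euclidean distance is below \<open>2 * M\<close>.\<close>
    let ?E = "A \<inter> {y. emb y \<in> ball (emb x) (2 * M)}"
    have "L K z \<subseteq> ?E"
    proof
      fix y assume y: "y \<in> L K z"
      note c = L_coords[OF x] L_coords[OF y]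
      have "\<bar>fst x - fst y\<bar> < m ^ K" "\<bar>snd x - snd y\<bar> < m ^ K" using c by linarith+
      then have "real_of_int \<bar>fst x - fst y\<bar> < real_of_int (m ^ K)"
        "real_of_int \<bar>snd x - snd y\<bar> < real_of_int (m ^ K)" by (simp_all only: of_int_less_iff)
      then have "dist (fst (emb x)) (fst (emb y)) < M" "dist (snd (emb x)) (snd (emb y)) < M"
        by (simp_all add: emb_def dist_real_def M_def)
      moreover have "dist (emb x) (emb y) \<le> dist (fst (emb x)) (fst (emb y)) + dist (snd (emb x)) (snd (emb y))"
        unfolding dist_prod_def by (rule sqrt_sum_squares_le_sum) auto
      ultimately have "emb y \<in> ball (emb x) (2 * M)" by simp
      then show "y \<in> ?E" using y L_subset_orbit[OF that] by blast
    qed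
    moreover have fin: "finite ?E"
    proof -
      have "?E \<subseteq> box_pts (emb x) (2 * M)"
      proof
        fix y assume "y \<in> ?E"
        then have "dist (emb x) (emb y) < 2 * M" by simp
        then have "dist (fst (emb x)) (fst (emb y)) < 2 * M" "dist (snd (emb x)) (snd (emb y)) < 2 * M"
          using dist_fst_le dist_snd_le le_less_trans by blast+
        then show "y \<in> box_pts (emb x) (2 * M)"
          by (simp add: box_pts_def emb_def dist_real_def abs_minus_commute)
      qed
      then show ?thesis by (rule finite_subset) simp
    qed
    ultimately have "N ^ K \<le> card ?E" using card_mono[of ?E "L K z"] by simp
    also have "\<dots> \<le> 4 * cover_num 1 ?E" by (rule card_le_cover_num[OF fin])
    finally have "real (N ^ K) \<le> real (4 * cover_num 1 ?E)" by (simp only: of_nat_le_iff)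
    moreover have "real (cover_num 1 ?E) \<le> C * (2 * M / 1) powr \<alpha>"
      using L_subset_orbit[OF that] x M by (intro C[rule_format]) auto
    ultimately have "M powr s \<le> 4 * (C * (2 * M) powr \<alpha>)" by (simp add: N_power_eq M_def)
    also have "(2 * M) powr \<alpha> = 2 powr \<alpha> * M powr \<alpha>" by (rule powr_mult)
    finally have "M powr s \<le> C' * M powr \<alpha>" by (simp add: C'_def)
    then have "M powr (s - \<alpha>) \<le> C'" using M by (simp add: powr_diff divide_le_eq)
    moreover have "M powr (s - \<alpha>) = (real_of_int m powr (s - \<alpha>)) ^ K"
      unfolding M_def using mp by (simp flip: powr_realpow add: powr_powr mult.commute)
    ultimately show ?thesis by simp
  qed
  have "s \<le> \<alpha>"
  proof (rule ccontr)
    assume "\<not> s \<le> \<alpha>"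
    then have g: "1 < real_of_int m powr (s - \<alpha>)" using mp by (intro gr_one_powr) auto
    then obtain n where "C' < (real_of_int m powr (s - \<alpha>)) ^ n" using real_arch_pow by blast
    also have "\<dots> \<le> (real_of_int m powr (s - \<alpha>)) ^ max n 1" using g by (intro power_increasing) auto
    also have "\<dots> \<le> C'" by (rule *) simp
    finally show False by simp
  qed
  then show "ereal s \<le> ereal \<alpha>" by simp
qed

end

theorem theorem1p2:
  fixes m n :: int and \<Lambda> :: "(int \<times> int) set" and z :: "int \<times> int"
  assumes "m = n" and "n \<ge> 2"
    and "\<Lambda> \<subseteq> {0..m - 1} \<times> {0..n - 1}" and "\<Lambda> \<noteq> {}"
  shows "dim_LM (orbit_plus m n \<Lambda> z) = dim_UM (orbit_plus m n \<Lambda> z) \<and>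
    (\<forall>Dim \<in> {dim_LH, dim_DH, lower_entropy_index, dim_M, dim_DP, dim_Be, dim_A}.
       Dim (orbit_plus m n \<Lambda> z) = ereal (log (real_of_int m) (real (card \<Lambda>))))"
proof -
  interpret digit_orbit m \<Lambda> z by unfold_locales (use assms in auto)
  \<comment> \<open>In each of the pairs \<open>dim_LH\<close>, \<open>dim_DH\<close> and
    \<open>lower_entropy_index\<close>, \<open>dim_DP\<close>, the lower bound for the smaller and
    the upper bound for the larger dimension determine both.\<close>
  have "dim_LH A = ereal s"
    by (rule antisym[OF order_trans[OF dim_LH_le_DH dim_DH_le] dim_LH_ge])
  moreover have "dim_DH A = ereal s"
    by (rule antisym[OF dim_DH_le order_trans[OF dim_LH_ge dim_LH_le_DH]])
  moreover have "lower_entropy_index A = ereal s"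
    by (rule antisym[OF order_trans[OF lower_entropy_index_le_DP dim_DP_le] lower_entropy_index_ge])
  moreover have "dim_DP A = ereal s"
    by (rule antisym[OF dim_DP_le order_trans[OF lower_entropy_index_ge lower_entropy_index_le_DP]])
  moreover have "dim_A A = ereal s" by (rule antisym[OF dim_A_le dim_A_ge])
  ultimately show ?thesis
    using \<open>m = n\<close>[symmetric] dim_LM_eq dim_UM_eq dim_Be_eq dim_M_eq by (simp add: s_def)
qed

end
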